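(* Let $k$ be a field, let $R=k[x_1,\dots,x_d]$ with its standard $\mathbb{Z}^d$-grading, and let $F$ be a finitely generated $\mathbb{Z}^d$-graded differential $R$-module whose differential $\delta:F\to F$ is homogeneous of degree zero, such that $F$ is free as an $R$-module. If the homology $H(F)=\ker\delta/\operatorname{im}\delta$ is non-zero and has finite length, then $\operatorname{rank}_R F\geq 2^d$.
   Context: The standard $\mathbb{Z}^d$-grading on $R=k[x_1,\dots,x_d]$ has $\deg(x_i)=(0,\dots,0,1,0,\dots,0)$, with the $1$ in the $i$-th coordinate. A $\mathbb{Z}^d$-graded differential $R$-module with differential of degree zero is a $\mathbb{Z}^d$-graded $R$-module $F=\bigoplus_{\mathbf m\in\mathbb{Z}^d}F_{\mathbf m}$ together with an $R$-linear map $\delta:F\to F$ satisfying $\delta(F_{\mathbf m})\subseteq F_{\mathbf m}$ for all $\mathbf m$ and $\delta^2=0$. *)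

theory Defs
  imports
    "HOL-Algebra.QuotRing"
    "HOL-Library.Poly_Mapping"
    "HOL-Library.Extended_Nat"
    "Jordan_Normal_Form.Missing_VectorSpace"
begin

text \<open>
  A monomial in \<open>x\<^sub>1, \<dots>, x\<^sub>d\<close> is an exponent vector \<open>nat \<Rightarrow>\<^sub>0 nat\<close> supported in \<open>{..<d}\<close>: the
  variable \<open>x\<^sub>i\<close> has index \<open>i - 1\<close>.  The type of all finitely supported maps from exponent vectors
  to \<open>'k\<close> is the polynomial ring in countably many variables; \<open>R = k[x\<^sub>1, \<dots>, x\<^sub>d]\<close> is its subring of
  polynomials in the first \<open>d\<close> variables.  Degrees in \<open>\<int>\<^sup>d\<close> are encoded in the same way.
\<close>

definition mpoly_ring :: "nat \<Rightarrow> ((nat \<Rightarrow>\<^sub>0 nat) \<Rightarrow>\<^sub>0 'k::field) ring" where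
  "mpoly_ring d =
    \<lparr>carrier = {p. \<forall>t \<in> Poly_Mapping.keys p. Poly_Mapping.keys t \<subseteq> {..<d}},
     mult = (*), one = 1, zero = 0, add = (+)\<rparr>"

definition int_lattice :: "nat \<Rightarrow> (nat \<Rightarrow>\<^sub>0 int) set" where
  "int_lattice d = {m. Poly_Mapping.keys m \<subseteq> {..<d}}"

text \<open>The standard grading: \<open>R\<^sub>n = k x\<^sup>n\<close>, which is zero if some entry of \<open>n\<close> is negative.\<close>

definition mpoly_component :: "nat \<Rightarrow> (nat \<Rightarrow>\<^sub>0 int) \<Rightarrow> ((nat \<Rightarrow>\<^sub>0 nat) \<Rightarrow>\<^sub>0 'k::field) set" where
  "mpoly_component d n =
    {p \<in> carrier (mpoly_ring d). \<forall>t \<in> Poly_Mapping.keys p. Poly_Mapping.map int t = n}"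

text \<open>The second axiom says that \<open>F\<close> is the internal direct sum of the components \<open>comp m\<close>.\<close>

locale Zd_graded_module =
  module "mpoly_ring d :: ((nat \<Rightarrow>\<^sub>0 nat) \<Rightarrow>\<^sub>0 'k::field) ring" F
  for d :: nat and F :: "((nat \<Rightarrow>\<^sub>0 nat) \<Rightarrow>\<^sub>0 'k::field, 'b, 'm) module_scheme" (structure) +
  fixes comp :: "(nat \<Rightarrow>\<^sub>0 int) \<Rightarrow> 'b set"
  assumes component_subgroup: "m \<in> int_lattice d \<Longrightarrow> additive_subgroup (comp m) F"
    and direct_decomposition:
      "x \<in> carrier F \<Longrightarrow>
        \<exists>!f. f \<in> (\<Pi> m \<in> int_lattice d. comp m) \<and>
          (\<forall>m. m \<notin> int_lattice d \<longrightarrow> f m = \<zero>\<^bsub>F\<^esub>) \<and>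
          finite {m. f m \<noteq> \<zero>\<^bsub>F\<^esub>} \<and>
          x = (\<Oplus>\<^bsub>F\<^esub> m \<in> {m. f m \<noteq> \<zero>\<^bsub>F\<^esub>}. f m)"
    and component_smult:
      "n \<in> int_lattice d \<Longrightarrow> m \<in> int_lattice d \<Longrightarrow>
        p \<in> mpoly_component d n \<Longrightarrow> x \<in> comp m \<Longrightarrow> p \<odot>\<^bsub>F\<^esub> x \<in> comp (n + m)"

locale Zd_graded_differential_module = Zd_graded_module d F comp
  for d :: nat and F :: "((nat \<Rightarrow>\<^sub>0 nat) \<Rightarrow>\<^sub>0 'k::field, 'b, 'm) module_scheme" (structure)
    and comp :: "(nat \<Rightarrow>\<^sub>0 int) \<Rightarrow> 'b set" +
  fixes \<delta> :: "'b \<Rightarrow> 'b"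
  assumes differential_hom: "\<delta> \<in> module_hom (mpoly_ring d) F F"
    and differential_degree_zero: "m \<in> int_lattice d \<Longrightarrow> \<delta> ` comp m \<subseteq> comp m"
    and differential_square: "x \<in> carrier F \<Longrightarrow> \<delta> (\<delta> x) = \<zero>\<^bsub>F\<^esub>"

text \<open>
  The fields \<open>mult\<close> and \<open>one\<close>, inherited by the module record from the ring record, play no role
  for modules and get dummy values.
\<close>

definition quotient_module ::
    "('a, 'b, 'm) module_scheme \<Rightarrow> 'b set \<Rightarrow> ('a, 'b set) module" where
  "quotient_module M N =
    \<lparr>carrier = a_rcosets\<^bsub>M\<^esub> N, mult = (\<lambda>X Y. N), one = N, zero = N, add = set_add M,
     smult = (\<lambda>a X. \<Union>x\<in>X. N +>\<^bsub>M\<^esub> (a \<odot>\<^bsub>M\<^esub> x))\<rparr>"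

definition homology ::
    "('a, 'b, 'm) module_scheme \<Rightarrow> ('b \<Rightarrow> 'b) \<Rightarrow> ('a, 'b set) module" where
  "homology F \<delta> = quotient_module (F\<lparr>carrier := mod_hom.ker F F \<delta>\<rparr>) (mod_hom.im F \<delta>)"

definition submodule_chain ::
    "('a, 'r) ring_scheme \<Rightarrow> ('a, 'b, 'm) module_scheme \<Rightarrow> nat \<Rightarrow> (nat \<Rightarrow> 'b set) \<Rightarrow> bool" where
  "submodule_chain R M n N \<longleftrightarrow>
    N 0 = {\<zero>\<^bsub>M\<^esub>} \<and> N n = carrier M \<and>
    (\<forall>i\<le>n. Module.submodule (N i) R M) \<and> (\<forall>i<n. N i \<subset> N (Suc i))"

definition module_length ::
    "('a, 'r) ring_scheme \<Rightarrow> ('a, 'b, 'm) module_scheme \<Rightarrow> enat" where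
  "module_length R M = Sup {enat n | n. \<exists>N. submodule_chain R M n N}"

definition finite_length ::
    "('a, 'r) ring_scheme \<Rightarrow> ('a, 'b, 'm) module_scheme \<Rightarrow> bool" where
  "finite_length R M \<longleftrightarrow> module_length R M < \<infinity>"

definition finitely_generated ::
    "('a, 'r) ring_scheme \<Rightarrow> ('a, 'b, 'm) module_scheme \<Rightarrow> bool" where
  "finitely_generated R M \<longleftrightarrow>
    (\<exists>S. finite S \<and> S \<subseteq> carrier M \<and> module.span R M S = carrier M)"

definition module_basis ::
    "('a, 'r) ring_scheme \<Rightarrow> ('a, 'b, 'm) module_scheme \<Rightarrow> 'b set \<Rightarrow> bool" where
  "module_basis R M B \<longleftrightarrow>
    B \<subseteq> carrier M \<and> \<not> module.lin_dep R M B \<and> module.span R M B = carrier M"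

definition free_module ::
    "('a, 'r) ring_scheme \<Rightarrow> ('a, 'b, 'm) module_scheme \<Rightarrow> bool" where
  "free_module R M \<longleftrightarrow> (\<exists>B. module_basis R M B)"

text \<open>
  Meant for finitely generated free modules over a nonzero commutative ring: there every basis is
  finite and any two bases have the same cardinality, so the choice does not matter.
\<close>

definition module_rank ::
    "('a, 'r) ring_scheme \<Rightarrow> ('a, 'b, 'm) module_scheme \<Rightarrow> nat" where
  "module_rank R M = card (SOME B. module_basis R M B)"

lemma mpoly_ring_cring: "cring (mpoly_ring d :: ((nat \<Rightarrow>\<^sub>0 nat) \<Rightarrow>\<^sub>0 'k::field) ring)"
proof -
  let ?C = "{p :: (nat \<Rightarrow>\<^sub>0 nat) \<Rightarrow>\<^sub>0 'k. \<forall>t \<in> Poly_Mapping.keys p. Poly_Mapping.keys t \<subseteq> {..<d}}"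
  have add: "p + q \<in> ?C" if "p \<in> ?C" "q \<in> ?C" for p q
    using that keys_add[of p q] by blast
  have mult: "p * q \<in> ?C" if pq: "p \<in> ?C" "q \<in> ?C" for p q
  proof -
    have "Poly_Mapping.keys t \<subseteq> {..<d}" if "t \<in> Poly_Mapping.keys (p * q)" for t
    proof -
      from that keys_mult[of p q] obtain a b where "t = a + b" "a \<in> Poly_Mapping.keys p" "b \<in> Poly_Mapping.keys q"
        by blast
      with pq keys_add[of a b] show ?thesis by blast
    qed
    then show ?thesis by blast
  qed
  have neg: "- p \<in> ?C" if "p \<in> ?C" for p
    using that by (simp add: in_keys_iff)
  have carr: "carrier (mpoly_ring d) = ?C"
    by (simp add: mpoly_ring_def)
  have ops: "x \<oplus>\<^bsub>mpoly_ring d\<^esub> y = x + y" "x \<otimes>\<^bsub>mpoly_ring d\<^esub> y = x * y"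
    "\<zero>\<^bsub>mpoly_ring d\<^esub> = 0" "\<one>\<^bsub>mpoly_ring d\<^esub> = 1"
    for x y :: "(nat \<Rightarrow>\<^sub>0 nat) \<Rightarrow>\<^sub>0 'k"
    by (simp_all add: mpoly_ring_def)
  have zero: "0 \<in> ?C" and one: "1 \<in> ?C"
    by simp_all
  show ?thesis
  proof (rule cringI)
    show "abelian_group (mpoly_ring d :: ((nat \<Rightarrow>\<^sub>0 nat) \<Rightarrow>\<^sub>0 'k) ring)"
    proof (rule abelian_groupI, unfold carr ops)
      show "\<exists>y\<in>?C. y + x = 0" if "x \<in> ?C" for x
        using neg[OF that] by (intro bexI[of _ "- x"]) simp_all
    qed (fact add zero | simp add: ac_simps)+
    show "comm_monoid (mpoly_ring d :: ((nat \<Rightarrow>\<^sub>0 nat) \<Rightarrow>\<^sub>0 'k) ring)"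
      by (rule comm_monoidI, unfold carr ops) (fact mult one | simp add: ac_simps)+
  qed (unfold ops, simp add: distrib_right)
qed

lemma (in module) smult_coset:
  assumes N: "Module.submodule N R M" and a: "a \<in> carrier R" and x: "x \<in> carrier M"
  shows "(\<Union>y\<in>N +>\<^bsub>M\<^esub> x. N +>\<^bsub>M\<^esub> (a \<odot>\<^bsub>M\<^esub> y)) = N +>\<^bsub>M\<^esub> (a \<odot>\<^bsub>M\<^esub> x)"
proof -
  interpret N: abelian_subgroup N M
    using N M.abelian_group_axioms
    by (intro abelian_subgroupI3 additive_subgroup.intro) (simp_all add: Module.submodule_def)
  have "N +>\<^bsub>M\<^esub> (a \<odot>\<^bsub>M\<^esub> y) = N +>\<^bsub>M\<^esub> (a \<odot>\<^bsub>M\<^esub> x)" if y: "y \<in> N +>\<^bsub>M\<^esub> x" for y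
  proof -
    from y obtain n where n: "n \<in> N" "y = n \<oplus>\<^bsub>M\<^esub> x"
      by (auto simp: a_r_coset_def r_coset_def)
    then have "a \<odot>\<^bsub>M\<^esub> y = a \<odot>\<^bsub>M\<^esub> n \<oplus>\<^bsub>M\<^esub> a \<odot>\<^bsub>M\<^esub> x"
      using a x N.a_subset by (simp add: smult_r_distr subsetD)
    moreover have "a \<odot>\<^bsub>M\<^esub> n \<in> N"
      using submoduleE(4)[OF N] a n by blast
    ultimately have "a \<odot>\<^bsub>M\<^esub> y \<in> N +>\<^bsub>M\<^esub> (a \<odot>\<^bsub>M\<^esub> x)"
      by (auto simp: a_r_coset_def r_coset_def)
    with a x show ?thesis
      using N.a_repr_independence' by simp
  qed
  moreover have "x \<in> N +>\<^bsub>M\<^esub> x"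
    using x by (rule N.a_rcos_self)
  ultimately show ?thesis by blast
qed

lemma (in module) quotient_module_is_module:
  assumes N: "Module.submodule N R M"
  shows "module R (quotient_module M N)"
proof -
  interpret N: abelian_subgroup N M
    using N M.abelian_group_axioms
    by (intro abelian_subgroupI3 additive_subgroup.intro) (simp_all add: Module.submodule_def)
  let ?Q = "quotient_module M N"
  have coset: "\<exists>x\<in>carrier M. X = N +>\<^bsub>M\<^esub> x" if "X \<in> carrier ?Q" for X
    using that by (auto simp: quotient_module_def A_RCOSETS_def RCOSETS_def a_r_coset_def)
  have coset_closed: "N +>\<^bsub>M\<^esub> x \<in> carrier ?Q" if "x \<in> carrier M" for x
    using that by (auto simp: quotient_module_def A_RCOSETS_def RCOSETS_def a_r_coset_def)
  have add: "(N +>\<^bsub>M\<^esub> x) \<oplus>\<^bsub>?Q\<^esub> (N +>\<^bsub>M\<^esub> y) = N +>\<^bsub>M\<^esub> (x \<oplus>\<^bsub>M\<^esub> y)"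
    if "x \<in> carrier M" "y \<in> carrier M" for x y
    using that by (simp add: quotient_module_def N.a_rcos_sum)
  have smult: "a \<odot>\<^bsub>?Q\<^esub> (N +>\<^bsub>M\<^esub> x) = N +>\<^bsub>M\<^esub> (a \<odot>\<^bsub>M\<^esub> x)"
    if "a \<in> carrier R" "x \<in> carrier M" for a x
    using smult_coset[OF N that] by (simp add: quotient_module_def)
  have zero: "\<zero>\<^bsub>?Q\<^esub> = N +>\<^bsub>M\<^esub> \<zero>\<^bsub>M\<^esub>"
    using N.a_rcos_const by (simp add: quotient_module_def)
  have ab: "abelian_group ?Q"
  proof (rule abelian_groupI)
    show "\<zero>\<^bsub>?Q\<^esub> \<in> carrier ?Q" by (simp add: zero coset_closed)
  next
    fix X Y assume "X \<in> carrier ?Q" "Y \<in> carrier ?Q"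
    then obtain x y where xy: "x \<in> carrier M" "X = N +>\<^bsub>M\<^esub> x" "y \<in> carrier M" "Y = N +>\<^bsub>M\<^esub> y"
      by (meson coset)
    then show "X \<oplus>\<^bsub>?Q\<^esub> Y \<in> carrier ?Q" by (simp add: add coset_closed)
    from xy show "X \<oplus>\<^bsub>?Q\<^esub> Y = Y \<oplus>\<^bsub>?Q\<^esub> X" by (simp add: add M.a_comm)
  next
    fix X Y Z assume "X \<in> carrier ?Q" "Y \<in> carrier ?Q" "Z \<in> carrier ?Q"
    then obtain x y z where "x \<in> carrier M" "X = N +>\<^bsub>M\<^esub> x" "y \<in> carrier M" "Y = N +>\<^bsub>M\<^esub> y"
      "z \<in> carrier M" "Z = N +>\<^bsub>M\<^esub> z"
      by (meson coset)
    then show "X \<oplus>\<^bsub>?Q\<^esub> Y \<oplus>\<^bsub>?Q\<^esub> Z = X \<oplus>\<^bsub>?Q\<^esub> (Y \<oplus>\<^bsub>?Q\<^esub> Z)" by (simp add: add M.a_assoc)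
  next
    fix X assume "X \<in> carrier ?Q"
    then obtain x where x: "x \<in> carrier M" "X = N +>\<^bsub>M\<^esub> x" by (meson coset)
    then show "\<zero>\<^bsub>?Q\<^esub> \<oplus>\<^bsub>?Q\<^esub> X = X" by (simp add: add zero)
    from x show "\<exists>Y\<in>carrier ?Q. Y \<oplus>\<^bsub>?Q\<^esub> X = \<zero>\<^bsub>?Q\<^esub>"
      by (intro bexI[of _ "N +>\<^bsub>M\<^esub> (\<ominus>\<^bsub>M\<^esub> x)"]) (simp_all add: add zero coset_closed M.l_neg)
  qed
  show ?thesis
  proof (rule moduleI)
    show "cring R" by (rule R.is_cring)
    show "abelian_group ?Q" by (rule ab)
  next
    fix a X assume a: "a \<in> carrier R" and "X \<in> carrier ?Q"
    then obtain x where "x \<in> carrier M" "X = N +>\<^bsub>M\<^esub> x" by (meson coset)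
    with a show "a \<odot>\<^bsub>?Q\<^esub> X \<in> carrier ?Q" by (simp add: smult coset_closed)
  next
    fix a b X assume ab: "a \<in> carrier R" "b \<in> carrier R" and "X \<in> carrier ?Q"
    then obtain x where x: "x \<in> carrier M" "X = N +>\<^bsub>M\<^esub> x" by (meson coset)
    from ab x show "(a \<oplus>\<^bsub>R\<^esub> b) \<odot>\<^bsub>?Q\<^esub> X = a \<odot>\<^bsub>?Q\<^esub> X \<oplus>\<^bsub>?Q\<^esub> b \<odot>\<^bsub>?Q\<^esub> X"
      by (simp add: smult add smult_l_distr)
    from ab x show "(a \<otimes>\<^bsub>R\<^esub> b) \<odot>\<^bsub>?Q\<^esub> X = a \<odot>\<^bsub>?Q\<^esub> (b \<odot>\<^bsub>?Q\<^esub> X)"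
      by (simp add: smult smult_assoc1)
  next
    fix a X Y assume a: "a \<in> carrier R" and "X \<in> carrier ?Q" "Y \<in> carrier ?Q"
    then obtain x y where "x \<in> carrier M" "X = N +>\<^bsub>M\<^esub> x" "y \<in> carrier M" "Y = N +>\<^bsub>M\<^esub> y"
      by (meson coset)
    with a show "a \<odot>\<^bsub>?Q\<^esub> (X \<oplus>\<^bsub>?Q\<^esub> Y) = a \<odot>\<^bsub>?Q\<^esub> X \<oplus>\<^bsub>?Q\<^esub> a \<odot>\<^bsub>?Q\<^esub> Y"
      by (simp add: smult add smult_r_distr)
  next
    fix X assume "X \<in> carrier ?Q"
    then obtain x where "x \<in> carrier M" "X = N +>\<^bsub>M\<^esub> x" by (meson coset)
    then show "\<one>\<^bsub>R\<^esub> \<odot>\<^bsub>?Q\<^esub> X = X" by (simp add: smult)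
  qed
qed

lemma (in Zd_graded_differential_module) homology_is_module:
  "module (mpoly_ring d) (homology F \<delta>)"
proof -
  interpret D: mod_hom "mpoly_ring d" F F \<delta>
    by (intro mod_hom.intro mod_hom_axioms.intro module_axioms differential_hom)
  let ?Z = "F\<lparr>carrier := D.ker\<rparr>"
  have ker: "module (mpoly_ring d) ?Z"
    using submodule_is_module[OF D.ker_is_submodule] by simp
  have im: "module (mpoly_ring d) (F\<lparr>carrier := D.im\<rparr>)"
    using submodule_is_module[OF D.im_is_submodule] by simp
  have "D.im \<subseteq> D.ker"
    using differential_square D.f_im by (auto simp: D.im_def D.ker_def)
  then have "Module.submodule D.im (mpoly_ring d) ?Z"
    using module.module_incl_imp_submodule[OF ker, of D.im] im by simp
  then show ?thesis
    unfolding homology_def by (rule module.quotient_module_is_module[OF ker])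
qed

end

theory Submission
  imports Defs "HOL-Library.Function_Algebras"
begin

text \<open>
  In a homogeneous basis, the component of \<open>F\<close> in degree \<open>m\<close> has the basis elements of degree at
  most \<open>m\<close>, times monomials, as a basis, so \<open>\<delta>\<close> is one square-zero matrix over \<open>k\<close> that respects
  degrees.  Let \<open>t\<close> be the last coordinate of a degree with homology.  Splitting the basis into the
  elements of last degree at most \<open>t\<close> and the others gives a short exact sequence of
  graded differential modules with one grading direction less, and its middle term is acyclic,
  because the homology of \<open>F\<close> vanishes in large degrees.  So both outer terms have the same homology,
  which is nonzero and vanishes in large degrees; by induction each of them has rank at least
  \<open>2\<^sup>d\<^sup>-\<^sup>1\<close>.
\<close>

section \<open>Differential vector spaces with a degree on the basis\<close>

text \<open>What the induction carries is weaker than finite length: an upper bound \<open>N\<close>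
  for all coordinates of all degrees with homology. It involves only the matrix and the degrees of
  the basis, and both halves inherit it with the same \<open>N\<close>. Finite length enters once,
  through the descending chain condition: filtering the homology by one coordinate of the degree at
  a time produces \<open>N\<close>. The other obstacle is that freeness supplies some basis,
  unrelated to the grading. In coordinates for this basis the grading becomes an arbitrary grading
  of R^B in which unit vectors may be inhomogeneous. A homogeneous basis is then built inside R^B
  and shown to have exactly \<open>card B\<close> elements, by linear algebra over k in k^B. So the
  count for the homogeneous basis is the count for the given one, and no invariance of rank over R
  is invoked.\<close>

definition matrix_apply :: "('j \<Rightarrow> 'j \<Rightarrow> 'k::field) \<Rightarrow> 'j set \<Rightarrow> ('j \<Rightarrow> 'k) \<Rightarrow> 'j \<Rightarrow> 'k" where
  "matrix_apply C S v i = (\<Sum>j\<in>S. C i j * v j)"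

definition square_zero_on :: "('j \<Rightarrow> 'j \<Rightarrow> 'k::field) \<Rightarrow> 'j set \<Rightarrow> bool" where
  "square_zero_on C S \<longleftrightarrow> (\<forall>i\<in>S. \<forall>k\<in>S. (\<Sum>j\<in>S. C i j * C j k) = 0)"

text \<open>Vectors are total functions, but only their values on \<open>S\<close> matter:
  \<open>matrix_apply\<close> reads no others, and both equations are imposed on \<open>S\<close>
  only.\<close>

definition acyclic_on :: "('j \<Rightarrow> 'j \<Rightarrow> 'k::field) \<Rightarrow> 'j set \<Rightarrow> bool" where
  "acyclic_on C S \<longleftrightarrow>
    (\<forall>v. (\<forall>i\<in>S. matrix_apply C S v i = 0) \<longrightarrow> (\<exists>w. \<forall>i\<in>S. matrix_apply C S w i = v i))"

lemma matrix_apply_square_zero: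
  assumes "square_zero_on C S" "i \<in> S"
  shows "matrix_apply C S (matrix_apply C S v) i = 0"
proof -
  have "matrix_apply C S (matrix_apply C S v) i = (\<Sum>j\<in>S. \<Sum>k\<in>S. C i j * (C j k * v k))"
    by (simp add: matrix_apply_def sum_distrib_left)
  also have "\<dots> = (\<Sum>k\<in>S. (\<Sum>j\<in>S. C i j * C j k) * v k)"
    by (subst sum.swap) (simp add: sum_distrib_right mult.assoc)
  also have "\<dots> = 0"
    using assms by (intro sum.neutral) (simp add: square_zero_on_def)
  finally show ?thesis .
qed

lemma matrix_apply_diff: "matrix_apply C S (\<lambda>j. v j - w j) i = matrix_apply C S v i - matrix_apply C S w i"
  by (simp add: matrix_apply_def algebra_simps sum_subtractf)

text \<open>Column \<open>j\<close> of \<open>C\<close> is the image of the \<open>j\<close>-th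
  basis vector, so \<open>triangular\<close> says that the span of \<open>S\<close> is stable under
  the differential; \<open>T\<close> indexes a basis of the quotient.\<close>

locale subcomplex =
  fixes C :: "'j \<Rightarrow> 'j \<Rightarrow> 'k::field" and S T :: "'j set"
  assumes fin: "finite S" "finite T" and disj: "S \<inter> T = {}"
    and square_zero: "square_zero_on C (S \<union> T)"
    and triangular: "\<And>i j. i \<in> T \<Longrightarrow> j \<in> S \<Longrightarrow> C i j = 0"
begin

lemma apply_Un: "matrix_apply C (S \<union> T) v i = matrix_apply C S v i + matrix_apply C T v i"
  unfolding matrix_apply_def using fin disj by (rule sum.union_disjoint)

lemma apply_sub: "i \<in> T \<Longrightarrow> matrix_apply C S v i = 0"
  unfolding matrix_apply_def by (intro sum.neutral) (simp add: triangular)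

lemma apply_restrict:
  "matrix_apply C S (\<lambda>j. if j \<in> S then v j else 0) i = matrix_apply C S v i"
  "matrix_apply C T (\<lambda>j. if j \<in> S then v j else 0) i = 0"
  "matrix_apply C T (\<lambda>j. if j \<in> T then v j else 0) i = matrix_apply C T v i"
  "matrix_apply C S (\<lambda>j. if j \<in> T then v j else 0) i = 0"
  using disj by (auto simp: matrix_apply_def intro!: sum.neutral)

lemma square_zero_parts: "square_zero_on C S" "square_zero_on C T"
proof -
  have eq: "(\<Sum>j\<in>S. C i j * C j k) + (\<Sum>j\<in>T. C i j * C j k) = 0"
    if "i \<in> S \<union> T" "k \<in> S \<union> T" for i k
  proof -
    have "(\<Sum>j\<in>S \<union> T. C i j * C j k) = 0"
      using square_zero that unfolding square_zero_on_def by blast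
    then show ?thesis using fin disj by (simp add: sum.union_disjoint)
  qed
  show "square_zero_on C S"
    unfolding square_zero_on_def
  proof (intro ballI)
    fix i k assume "i \<in> S" "k \<in> S"
    then show "(\<Sum>j\<in>S. C i j * C j k) = 0"
      using eq[of i k] by (simp add: triangular)
  qed
  show "square_zero_on C T"
    unfolding square_zero_on_def
  proof (intro ballI)
    fix i k assume "i \<in> T" "k \<in> T"
    then show "(\<Sum>j\<in>T. C i j * C j k) = 0"
      using eq[of i k] by (simp add: triangular)
  qed
qed

text \<open>Diagram chase: a primitive \<open>w\<close> of the extended cycle has a
  \<open>T\<close>-part that is a cycle of the quotient, hence a boundary there. Subtracting the
  differential of a lift \<open>u'\<close> of its primitive moves \<open>w\<close> into
  \<open>S\<close>.\<close>

lemma acyclic_sub: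
  assumes U: "acyclic_on C (S \<union> T)" and T: "acyclic_on C T"
  shows "acyclic_on C S"
  unfolding acyclic_on_def
proof (intro allI impI)
  fix v assume v: "\<forall>i\<in>S. matrix_apply C S v i = 0"
  define v' where "v' = (\<lambda>j. if j \<in> S then v j else 0)"
  have "\<forall>i\<in>S \<union> T. matrix_apply C (S \<union> T) v' i = 0"
    using v apply_sub by (auto simp: apply_Un v'_def apply_restrict)
  with U obtain w where w: "\<forall>i\<in>S \<union> T. matrix_apply C (S \<union> T) w i = v' i"
    by (auto simp: acyclic_on_def)
  have "\<forall>i\<in>T. matrix_apply C T w i = 0"
  proof
    fix i assume "i \<in> T"
    with w disj show "matrix_apply C T w i = 0"
      by (auto simp: apply_Un apply_sub v'_def split: if_splits)
  qed
  with T obtain u where u: "\<forall>i\<in>T. matrix_apply C T u i = w i"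
    by (auto simp: acyclic_on_def)
  define u' where "u' = (\<lambda>j. if j \<in> T then u j else 0)"
  define w' where "w' = (\<lambda>j. w j - matrix_apply C (S \<union> T) u' j)"
  have "w' i = 0" if "i \<in> T" for i
    using that u by (simp add: w'_def apply_Un u'_def apply_restrict)
  then have "matrix_apply C T w' i = 0" for i
    by (simp add: matrix_apply_def)
  moreover have "matrix_apply C (S \<union> T) w' i = v' i" if "i \<in> S \<union> T" for i
    using that w matrix_apply_square_zero[OF square_zero] by (simp add: w'_def matrix_apply_diff)
  ultimately have "matrix_apply C S w' i = v i" if "i \<in> S" for i
    using that by (metis UnI1 add.right_neutral apply_Un v'_def)
  then show "\<exists>w. \<forall>i\<in>S. matrix_apply C S w i = v i" by blast
qed

text \<open>The other chase: a cycle of the quotient lifts to a vector whose differential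
  \<open>z\<close> lies in \<open>S\<close> and is a cycle there. A primitive of \<open>z\<close>
  corrects the lift to a cycle of the whole, and the primitive of this cycle is the one wanted on
  \<open>T\<close>.\<close>

lemma acyclic_quotient:
  assumes U: "acyclic_on C (S \<union> T)" and S: "acyclic_on C S"
  shows "acyclic_on C T"
  unfolding acyclic_on_def
proof (intro allI impI)
  fix v assume v: "\<forall>i\<in>T. matrix_apply C T v i = 0"
  define v' where "v' = (\<lambda>j. if j \<in> T then v j else 0)"
  define z where "z = matrix_apply C (S \<union> T) v'"
  have zT: "z i = 0" if "i \<in> T" for i
    using v that apply_sub by (simp add: z_def apply_Un v'_def apply_restrict)
  then have "matrix_apply C T z i = 0" for i
    by (simp add: matrix_apply_def)
  then have "\<forall>i\<in>S. matrix_apply C S z i = 0"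
    using matrix_apply_square_zero[OF square_zero, of _ v'] by (auto simp: apply_Un z_def)
  with S obtain u where u: "\<forall>i\<in>S. matrix_apply C S u i = z i"
    by (auto simp: acyclic_on_def)
  define u' where "u' = (\<lambda>j. if j \<in> S then u j else 0)"
  have "matrix_apply C (S \<union> T) u' i = z i" if "i \<in> S \<union> T" for i
    using that u zT apply_sub by (auto simp: apply_Un u'_def apply_restrict)
  then have "\<forall>i\<in>S \<union> T. matrix_apply C (S \<union> T) (\<lambda>j. v' j - u' j) i = 0"
    by (simp add: matrix_apply_diff z_def)
  with U obtain w where w: "\<forall>i\<in>S \<union> T. matrix_apply C (S \<union> T) w i = v' i - u' i"
    unfolding acyclic_on_def by blast
  have "matrix_apply C T w i = v i" if "i \<in> T" for i
  proof -
    have "matrix_apply C (S \<union> T) w i = v' i - u' i" using w that by blast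
    moreover have "i \<notin> S" using that disj by blast
    ultimately show ?thesis
      using that by (simp add: apply_Un apply_sub v'_def u'_def)
  qed
  then show "\<exists>w. \<forall>i\<in>T. matrix_apply C T w i = v i" by blast
qed

text \<open>Here \<open>U\<close> is stable under the differential, so a composite that starts in
  \<open>U\<close> has no nonzero term through the outside. It is applied with \<open>U\<close>
  given by an upper bound on degrees.\<close>

lemma subcomplex_Int:
  assumes "\<And>i j. C i j \<noteq> 0 \<Longrightarrow> i \<in> S \<union> T \<Longrightarrow> j \<in> S \<union> T \<Longrightarrow> j \<in> U \<Longrightarrow> i \<in> U"
  shows "subcomplex C (S \<inter> U) (T \<inter> U)"
proof
  have "(\<Sum>j\<in>(S \<union> T) \<inter> U. C i j * C j k) = (\<Sum>j\<in>S \<union> T. C i j * C j k)" if "k \<in> S \<union> T" "k \<in> U" for i k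
    using fin assms that by (intro sum.mono_neutral_left) auto
  then show "square_zero_on C (S \<inter> U \<union> T \<inter> U)"
    using square_zero unfolding square_zero_on_def Int_Un_distrib2[symmetric] by simp
qed (use fin disj triangular in auto)

end

text \<open>The set \<open>{j\<in>S. \<forall>l<d. a j l \<le> m l}\<close> indexes a basis of the
  degree-\<open>m\<close> part. Thus the fourth assumption bounds the degrees with homology, and the
  fifth provides one of them.\<close>

theorem two_power_le_card:
  fixes a :: "'j \<Rightarrow> nat \<Rightarrow> int" and C :: "'j \<Rightarrow> 'j \<Rightarrow> 'k::field"
  assumes "finite S" "square_zero_on C S"
    and "\<And>i j l. i \<in> S \<Longrightarrow> j \<in> S \<Longrightarrow> C i j \<noteq> 0 \<Longrightarrow> l < d \<Longrightarrow> a i l \<le> a j l"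
    and "\<And>m l. l < d \<Longrightarrow> \<not> acyclic_on C {j\<in>S. \<forall>l<d. a j l \<le> m l} \<Longrightarrow> m l \<le> N"
    and "\<not> acyclic_on C {j\<in>S. \<forall>l<d. a j l \<le> m l}"
  shows "2 ^ d \<le> card S"
  using assms
proof (induction d arbitrary: S m)
  case 0
  \<comment> \<open>Without coordinates the bound selects all of \<open>S\<close>, and an empty
    matrix would be acyclic.\<close>
  have "S \<noteq> {}"
    using "0.prems"(5) by (auto simp: acyclic_on_def)
  with \<open>finite S\<close> show ?case
    by (simp add: Suc_leI card_gt_0_iff)
next
  case (Suc d)
  note fin = \<open>finite S\<close> and sq = \<open>square_zero_on C S\<close>
  \<comment> \<open>With this \<open>t\<close>, the bound \<open>m\<close> selects the same elements
    from \<open>S1\<close> as from \<open>S\<close>, so the given inexact degree stays inexact for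
    \<open>S1\<close>.\<close>
  define t where "t = m d"
  define S1 where "S1 = {j\<in>S. a j d \<le> t}"
  define S2 where "S2 = {j\<in>S. \<not> a j d \<le> t}"
  \<comment> \<open>\<open>N + 1\<close> puts the last coordinate beyond all homology, and the other
    entries make the bound \<open>M\<close> hold on all of \<open>S\<close>. This yields the acyclic
    middle term \<open>large\<close>.\<close>
  define M where "M = Max (insert (N + 1) ((\<lambda>j. a j d) ` S))"
  define U where "U n = {j. \<forall>l<d. a j l \<le> n l}" for n :: "nat \<Rightarrow> int"
  have S: "S = S1 \<union> S2" by (auto simp: S1_def S2_def)
  have M: "M > N" "\<And>j. j \<in> S \<Longrightarrow> a j d \<le> M"
    using fin by (auto simp: M_def Max_gr_iff Max_ge_iff)
  interpret split: subcomplex C S1 S2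
  proof
    fix i j assume "i \<in> S2" "j \<in> S1"
    then show "C i j = 0"
      using Suc.prems(3)[of i j d] by (force simp: S1_def S2_def)
  qed (use fin sq in \<open>simp_all flip: S\<close>, auto simp: S1_def S2_def fin)
  have cone: "subcomplex C (S1 \<inter> U n) (S2 \<inter> U n)" for n
  proof (rule split.subcomplex_Int)
    fix i j assume *: "C i j \<noteq> 0" "i \<in> S1 \<union> S2" "j \<in> S1 \<union> S2" "j \<in> U n"
    have "a i l \<le> n l" if "l < d" for l
    proof (rule order_trans)
      show "a i l \<le> a j l" using * that by (intro Suc.prems(3)) (simp_all add: S)
      show "a j l \<le> n l" using * that by (simp add: U_def)
    qed
    then show "i \<in> U n" by (simp add: U_def)
  qed
  have large: "acyclic_on C (S \<inter> U n)" for n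
  proof -
    have "{j\<in>S. \<forall>l<Suc d. a j l \<le> (n(d := M)) l} = S \<inter> U n"
      using M(2) by (auto simp: U_def less_Suc_eq)
    with Suc.prems(4)[of d "n(d := M)"] M(1) show ?thesis by auto
  qed
  \<comment> \<open>Freezing the last coordinate at \<open>t\<close> turns a bound for
    \<open>S1\<close> into a bound for \<open>S\<close>. So the estimate by \<open>N\<close> passes
    to \<open>S1\<close>, and through \<open>acyclic_iff\<close> to \<open>S2\<close>.\<close>
  have S1: "S1 \<inter> U n = {j\<in>S. \<forall>l<Suc d. a j l \<le> (n(d := t)) l}" for n
    by (auto simp: U_def S1_def less_Suc_eq)
  have U: "R \<inter> U n = {j\<in>R. \<forall>l<d. a j l \<le> n l}" for n R
    by (auto simp: U_def)
  have bound1: "n l \<le> N" if "\<not> acyclic_on C (S1 \<inter> U n)" "l < d" for n l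
    using Suc.prems(4)[of l "n(d := t)"] that unfolding S1 by simp
  have acyclic_iff: "acyclic_on C (S2 \<inter> U n) \<longleftrightarrow> acyclic_on C (S1 \<inter> U n)" for n
  proof -
    interpret subcomplex C "S1 \<inter> U n" "S2 \<inter> U n" by (rule cone)
    have "acyclic_on C ((S1 \<inter> U n) \<union> (S2 \<inter> U n))"
      using large[of n] by (simp add: S Int_Un_distrib2)
    then show ?thesis using acyclic_sub acyclic_quotient by blast
  qed
  have "m(d := t) = m" by (simp add: t_def)
  then have non1: "\<not> acyclic_on C (S1 \<inter> U m)"
    using Suc.prems(5) S1[of m] by simp
  have "2 ^ d \<le> card S1"
  proof (rule Suc.IH)
    show "n l \<le> N" if "l < d" "\<not> acyclic_on C {j \<in> S1. \<forall>l<d. a j l \<le> n l}" for n l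
      using that bound1 unfolding U[symmetric] by blast
    show "\<not> acyclic_on C {j \<in> S1. \<forall>l<d. a j l \<le> m l}"
      using non1 unfolding U .
  qed (use Suc.prems(3) split.fin split.square_zero_parts S in auto)
  moreover have "2 ^ d \<le> card S2"
  proof (rule Suc.IH)
    show "n l \<le> N" if "l < d" "\<not> acyclic_on C {j \<in> S2. \<forall>l<d. a j l \<le> n l}" for n l
      using that bound1 unfolding U[symmetric] acyclic_iff by blast
    show "\<not> acyclic_on C {j \<in> S2. \<forall>l<d. a j l \<le> m l}"
      using non1 acyclic_iff unfolding U by blast
  qed (use Suc.prems(3) split.fin split.square_zero_parts S in auto)
  ultimately show ?case
    using split.fin split.disj by (simp add: S card_Un_disjoint)
qed

section \<open>Graded submodules of coordinate vectors\<close>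

lemma lookup_map_int [simp]: "Poly_Mapping.lookup (Poly_Mapping.map int t) l = int (Poly_Mapping.lookup t l)"
  by (simp add: Poly_Mapping.map.rep_eq when_def)

lemma map_int_zero [simp]: "Poly_Mapping.map int 0 = 0"
  by (rule poly_mapping_eqI) simp

lemma keys_map_int [simp]: "Poly_Mapping.keys (Poly_Mapping.map int t) = Poly_Mapping.keys t"
  by (auto simp: in_keys_iff)

lemma sum_single_lookup: "(\<Sum>t\<in>Poly_Mapping.keys p. Poly_Mapping.single t (Poly_Mapping.lookup p t)) = p"
  by (rule poly_mapping_eqI) (auto simp: lookup_sum lookup_single when_def in_keys_iff)

text \<open>The value at (1, ..., 1): a monomial factor does not change it, so homogeneous elements
  of different degrees can be compared in one vector space over k.\<close>

definition coeff_sum :: "('a \<Rightarrow>\<^sub>0 'k::comm_semiring_1) \<Rightarrow> 'k" where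
  "coeff_sum p = (\<Sum>t\<in>Poly_Mapping.keys p. Poly_Mapping.lookup p t)"

lemma coeff_sum_add: "coeff_sum (p + q) = coeff_sum p + coeff_sum q"
  unfolding coeff_sum_def by (rule setsum_keys_plus_distrib) simp_all

lemma coeff_sum_0 [simp]: "coeff_sum 0 = 0"
  by (simp add: coeff_sum_def)

lemma coeff_sum_sum: "coeff_sum (\<Sum>i\<in>I. p i) = (\<Sum>i\<in>I. coeff_sum (p i))"
  by (induction I rule: infinite_finite_induct) (simp_all add: coeff_sum_add)

lemma coeff_sum_single [simp]: "coeff_sum (Poly_Mapping.single t c) = c"
  by (simp add: coeff_sum_def)

lemma coeff_sum_single_mult: "coeff_sum (Poly_Mapping.single t c * p) = c * coeff_sum p"
proof -
  have "Poly_Mapping.single t c * p = (\<Sum>s\<in>Poly_Mapping.keys p. Poly_Mapping.single (t + s) (c * Poly_Mapping.lookup p s))"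
    by (subst (1) sum_single_lookup[of p, symmetric]) (simp add: sum_distrib_left mult_single)
  then show ?thesis
    by (simp add: coeff_sum_sum sum_distrib_left) (simp add: coeff_sum_def sum_distrib_left)
qed

lemma lookup_single_zero_mult: "Poly_Mapping.lookup (Poly_Mapping.single 0 c * p) t = c * Poly_Mapping.lookup p t"
  by (simp add: mult_map_scale_conv_mult[symmetric] Poly_Mapping.map.rep_eq when_def)

lemma sum_fun_apply: "(\<Sum>i\<in>I. f i) x = (\<Sum>i\<in>I. f i x)"
  by (induction I rule: infinite_finite_induct) simp_all

lemma mpoly_ring_simps [simp]:
  "x \<oplus>\<^bsub>mpoly_ring d\<^esub> y = x + y" "x \<otimes>\<^bsub>mpoly_ring d\<^esub> y = x * y"
  "\<zero>\<^bsub>mpoly_ring d\<^esub> = 0" "\<one>\<^bsub>mpoly_ring d\<^esub> = 1"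
  by (simp_all add: mpoly_ring_def)

lemma carrier_mpoly_ring:
  "p \<in> carrier (mpoly_ring d) \<longleftrightarrow> (\<forall>t\<in>Poly_Mapping.keys p. Poly_Mapping.keys t \<subseteq> {..<d})"
  by (simp add: mpoly_ring_def)

lemma single_in_mpoly_ring: "Poly_Mapping.keys t \<subseteq> {..<d} \<Longrightarrow> Poly_Mapping.single t c \<in> carrier (mpoly_ring d)"
  by (simp add: carrier_mpoly_ring)

section \<open>Coordinate vectors with entries in R or in k\<close>

type_synonym ('b, 'k) vec = "'b \<Rightarrow> (nat \<Rightarrow>\<^sub>0 nat) \<Rightarrow>\<^sub>0 'k"

text \<open>Polymorphic because it serves both as the action of R on R^B and as the action of k on
  vectors of scalars, the vector space \<open>coord\<close>.\<close>

definition scale_vec :: "('a::times) \<Rightarrow> ('b \<Rightarrow> 'a) \<Rightarrow> 'b \<Rightarrow> 'a" where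
  "scale_vec p v = (\<lambda>b. p * v b)"

lemma scale_vec_apply [simp]: "scale_vec p v b = p * v b"
  by (simp add: scale_vec_def)

lemma scale_vec_simps:
  fixes p q :: "'a::comm_ring_1"
  shows "scale_vec p (v + w) = scale_vec p v + scale_vec p w"
    "scale_vec (p + q) v = scale_vec p v + scale_vec q v"
    "scale_vec (p * q) v = scale_vec p (scale_vec q v)"
    "scale_vec p 0 = 0" "scale_vec 0 v = 0" "scale_vec 1 v = v" "scale_vec (- 1) v = - v"
  by (simp_all add: fun_eq_iff algebra_simps)

lemma scale_vec_sum: "scale_vec (p::'a::comm_ring_1) (\<Sum>i\<in>I. v i) = (\<Sum>i\<in>I. scale_vec p (v i))"
  by (simp add: fun_eq_iff sum_fun_apply sum_distrib_left)

lemma scale_vec_sum_left: "scale_vec (\<Sum>i\<in>I. p i :: 'a::comm_ring_1) v = (\<Sum>i\<in>I. scale_vec (p i) v)"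
  by (simp add: fun_eq_iff sum_fun_apply sum_distrib_right)

interpretation coord: vector_space "scale_vec :: 'k::field \<Rightarrow> ('b \<Rightarrow> 'k) \<Rightarrow> 'b \<Rightarrow> 'k"
  by standard (simp_all add: scale_vec_simps)

definition unit_vec :: "'b \<Rightarrow> 'b \<Rightarrow> 'a::zero_neq_one" where
  "unit_vec b = (\<lambda>b'. if b' = b then 1 else 0)"

lemma inj_unit_vec: "inj unit_vec"
  by (rule injI) (metis unit_vec_def zero_neq_one)

lemma independent_unit_vecs: "coord.independent (unit_vec ` (B :: 'b set) :: ('b \<Rightarrow> 'k::field) set)"
proof
  assume "coord.dependent (unit_vec ` B :: ('b \<Rightarrow> 'k) set)"
  then obtain t and u :: "('b \<Rightarrow> 'k) \<Rightarrow> 'k" and w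
    where t: "finite t" "t \<subseteq> unit_vec ` B" "(\<Sum>v\<in>t. scale_vec (u v) v) = 0" and w: "w \<in> t" "u w \<noteq> 0"
    unfolding coord.dependent_explicit by blast
  from t w obtain b where b: "unit_vec b \<in> t" "u (unit_vec b) \<noteq> 0"
    by blast
  have "0 = (\<Sum>v\<in>t. u v * v b)"
    using t(3) by (simp add: fun_eq_iff sum_fun_apply)
  also have "\<dots> = (\<Sum>v\<in>{unit_vec b}. u v * v b)"
    using t b by (intro sum.mono_neutral_right) (auto simp: unit_vec_def split: if_splits)
  finally show False using b(2) by (simp add: unit_vec_def)
qed

definition free_vecs :: "nat \<Rightarrow> 'b set \<Rightarrow> ('b, 'k::field) vec set" where
  "free_vecs d B = {v. (\<forall>b. v b \<in> carrier (mpoly_ring d)) \<and> (\<forall>b. b \<notin> B \<longrightarrow> v b = 0)}"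

lemma free_vecs_zero: "0 \<in> free_vecs d B"
  by (simp add: free_vecs_def carrier_mpoly_ring)

lemma free_vecs_add:
  fixes x y :: "('b, 'k::field) vec"
  assumes "x \<in> free_vecs d B" "y \<in> free_vecs d B"
  shows "x + y \<in> free_vecs d B"
proof -
  interpret R: cring "mpoly_ring d :: ((nat \<Rightarrow>\<^sub>0 nat) \<Rightarrow>\<^sub>0 'k) ring"
    by (rule mpoly_ring_cring)
  show ?thesis using assms R.a_closed by (auto simp: free_vecs_def)
qed

lemma free_vecs_smult:
  fixes x :: "('b, 'k::field) vec"
  assumes "p \<in> carrier (mpoly_ring d)" "x \<in> free_vecs d B"
  shows "scale_vec p x \<in> free_vecs d B"
proof -
  interpret R: cring "mpoly_ring d :: ((nat \<Rightarrow>\<^sub>0 nat) \<Rightarrow>\<^sub>0 'k) ring"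
    by (rule mpoly_ring_cring)
  show ?thesis using assms R.m_closed by (auto simp: free_vecs_def)
qed

lemma free_vecs_sum: "(\<And>i. i \<in> I \<Longrightarrow> f i \<in> free_vecs d B) \<Longrightarrow> (\<Sum>i\<in>I. f i) \<in> free_vecs d B"
  by (induction I rule: infinite_finite_induct) (simp_all add: free_vecs_zero free_vecs_add)

text \<open>A grading of R^B in which the unit vectors need not be homogeneous. Uniqueness of
  decompositions is stated for zero only. Degrees range over the whole type, with nothing but zero
  off the lattice.\<close>

locale graded_free =
  fixes d :: nat and B :: "'b set" and comp :: "(nat \<Rightarrow>\<^sub>0 int) \<Rightarrow> ('b, 'k::field) vec set"
  assumes finite_B: "finite B"
    and comp_F: "x \<in> comp m \<Longrightarrow> x \<in> free_vecs d B"
    and comp_lattice: "x \<in> comp m \<Longrightarrow> x \<noteq> 0 \<Longrightarrow> m \<in> int_lattice d"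
    and comp_zero: "0 \<in> comp m"
    and comp_add: "x \<in> comp m \<Longrightarrow> y \<in> comp m \<Longrightarrow> x + y \<in> comp m"
    and comp_smult: "Poly_Mapping.keys t \<subseteq> {..<d} \<Longrightarrow> x \<in> comp m \<Longrightarrow>
      scale_vec (Poly_Mapping.single t c) x \<in> comp (Poly_Mapping.map int t + m)"
    and decomposition: "x \<in> free_vecs d B \<Longrightarrow> \<exists>f. (\<forall>m. f m \<in> comp m) \<and> finite {m. f m \<noteq> 0} \<and> x = (\<Sum>m | f m \<noteq> 0. f m)"
    and decomposition_zero: "(\<And>m. f m \<in> comp m) \<Longrightarrow> finite {m. f m \<noteq> 0} \<Longrightarrow> (\<Sum>m | f m \<noteq> 0. f m) = 0 \<Longrightarrow> f m = 0"
begin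

abbreviation F :: "('b, 'k) vec set" where
  "F \<equiv> free_vecs d B"

lemma comp_sum: "(\<And>i. i \<in> I \<Longrightarrow> f i \<in> comp m) \<Longrightarrow> (\<Sum>i\<in>I. f i) \<in> comp m"
  by (induction I rule: infinite_finite_induct) (simp_all add: comp_zero comp_add)

lemma comp_scalar: "x \<in> comp m \<Longrightarrow> scale_vec (Poly_Mapping.single 0 c) x \<in> comp m"
  using comp_smult[of 0 x m c] by simp

lemma comp_uminus: "x \<in> comp m \<Longrightarrow> - x \<in> comp m"
  using comp_scalar[of x m "- 1"] by (simp add: scale_vec_simps single_uminus)

lemma comp_diff: "x \<in> comp m \<Longrightarrow> y \<in> comp m \<Longrightarrow> x - y \<in> comp m"
  using comp_add[of x m "- y"] comp_uminus by simp

text \<open>The homogeneous component of degree \<open>m\<close>. The chosen family \<open>f\<close>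
  does not depend on that \<open>m\<close>, so one decomposition supplies all components of
  \<open>x\<close>.\<close>

definition part :: "(nat \<Rightarrow>\<^sub>0 int) \<Rightarrow> ('b, 'k) vec \<Rightarrow> ('b, 'k) vec" where
  "part m x = (SOME f. (\<forall>m. f m \<in> comp m) \<and> finite {m. f m \<noteq> 0} \<and> x = (\<Sum>m | f m \<noteq> 0. f m)) m"

lemma
  assumes "x \<in> F"
  shows part_comp: "part m x \<in> comp m" and finite_parts: "finite {m. part m x \<noteq> 0}"
    and sum_parts: "(\<Sum>m | part m x \<noteq> 0. part m x) = x"
proof -
  note someI_ex[OF decomposition[OF assms]]
  then show "part m x \<in> comp m" "finite {m. part m x \<noteq> 0}" "(\<Sum>m | part m x \<noteq> 0. part m x) = x"
    unfolding part_def by simp_all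
qed

text \<open>The difference of two decompositions decomposes zero, hence vanishes. \<open>M\<close>
  may exceed the support of \<open>f\<close>, which suits sums and monomial multiples.\<close>

lemma part_eqI:
  assumes "\<And>m. f m \<in> comp m" "finite M" "\<And>m. m \<notin> M \<Longrightarrow> f m = 0" "(\<Sum>m\<in>M. f m) = x"
  shows "part m x = f m"
proof -
  have x: "x \<in> F" using assms comp_F by (metis free_vecs_sum)
  define g where "g m = part m x - f m" for m
  define K where "K = M \<union> {m. part m x \<noteq> 0}"
  have K: "finite K" "{m. g m \<noteq> 0} \<subseteq> K"
    using finite_parts[OF x] assms by (auto simp: K_def g_def)
  have "(\<Sum>m | g m \<noteq> 0. g m) = (\<Sum>m\<in>K. g m)"
    using K by (intro sum.mono_neutral_left) auto
  also have "\<dots> = (\<Sum>m\<in>K. part m x) - (\<Sum>m\<in>K. f m)"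
    by (simp add: g_def sum_subtractf)
  also have "(\<Sum>m\<in>K. part m x) = (\<Sum>m | part m x \<noteq> 0. part m x)"
    using K by (intro sum.mono_neutral_right) (auto simp: K_def)
  also have "(\<Sum>m\<in>K. f m) = (\<Sum>m\<in>M. f m)"
    using K assms by (intro sum.mono_neutral_right) (auto simp: K_def)
  finally have "(\<Sum>m | g m \<noteq> 0. g m) = 0"
    using assms(4) sum_parts[OF x] by (simp only: diff_self)
  moreover have "g m \<in> comp m" for m
    using assms part_comp[OF x] comp_diff by (simp add: g_def)
  ultimately have "g m = 0"
    using decomposition_zero K finite_subset by metis
  then show ?thesis by (simp add: g_def)
qed

lemma part_of_comp: "x \<in> comp m \<Longrightarrow> part n x = (if n = m then x else 0)"
  by (rule part_eqI[where f = "\<lambda>n. if n = m then x else 0" and M = "{m}"]) (simp_all add: comp_zero)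

lemma part_add:
  assumes "x \<in> F" "y \<in> F"
  shows "part m (x + y) = part m x + part m y"
proof (rule part_eqI)
  let ?M = "{m. part m x \<noteq> 0} \<union> {m. part m y \<noteq> 0}"
  show "part m x + part m y \<in> comp m" for m
    using assms part_comp comp_add by blast
  show fin: "finite ?M" using assms finite_parts by blast
  have "(\<Sum>m\<in>?M. part m x) = x" "(\<Sum>m\<in>?M. part m y) = y"
    using fin assms sum_parts
    by (subst sum.mono_neutral_right[of ?M]; force)+
  then show "(\<Sum>m\<in>?M. part m x + part m y) = x + y"
    by (simp add: sum.distrib)
qed auto

lemma part_zero [simp]: "part m 0 = 0"
  using part_of_comp[OF comp_zero[of m], of m] by simp

lemma part_sum: "(\<And>i. i \<in> I \<Longrightarrow> f i \<in> F) \<Longrightarrow> part m (\<Sum>i\<in>I. f i) = (\<Sum>i\<in>I. part m (f i))"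
  by (induction I rule: infinite_finite_induct) (simp_all add: part_add free_vecs_sum)

lemma part_smult:
  assumes "x \<in> F" "Poly_Mapping.keys t \<subseteq> {..<d}"
  shows "part m (scale_vec (Poly_Mapping.single t c) x)
    = scale_vec (Poly_Mapping.single t c) (part (m - Poly_Mapping.map int t) x)"
proof (rule part_eqI)
  let ?t = "Poly_Mapping.map int t"
  let ?M = "{m. part m x \<noteq> 0}"
  show "scale_vec (Poly_Mapping.single t c) (part (m - ?t) x) \<in> comp m" for m
    using comp_smult[OF assms(2) part_comp[OF assms(1)], of c "m - ?t"] by simp
  show "finite ((+) ?t ` ?M)"
    using finite_parts[OF assms(1)] by simp
  show "scale_vec (Poly_Mapping.single t c) (part (m - ?t) x) = 0" if "m \<notin> (+) ?t ` ?M" for m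
  proof -
    have "m = ?t + (m - ?t)" by simp
    with that have "part (m - ?t) x = 0" by blast
    then show ?thesis by (simp add: scale_vec_simps)
  qed
  have "(\<Sum>m\<in>(+) ?t ` ?M. scale_vec (Poly_Mapping.single t c) (part (m - ?t) x))
    = scale_vec (Poly_Mapping.single t c) (\<Sum>m\<in>?M. part m x)"
    by (subst sum.reindex) (auto simp: scale_vec_sum)
  then show "(\<Sum>m\<in>(+) ?t ` ?M. scale_vec (Poly_Mapping.single t c) (part (m - ?t) x))
    = scale_vec (Poly_Mapping.single t c) x"
    by (simp add: sum_parts[OF assms(1)])
qed

lemma unit_vec_F: "b \<in> B \<Longrightarrow> unit_vec b \<in> F"
  by (auto simp: free_vecs_def unit_vec_def carrier_mpoly_ring)

text \<open>A monomial x^t moves degree \<open>m - t\<close> to degree \<open>m\<close>. So every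
  homogeneous element is controlled by the finitely many components of the unit vectors.\<close>

lemma part_expand:
  assumes "x \<in> F"
  shows "part m x = (\<Sum>b\<in>B. \<Sum>t\<in>Poly_Mapping.keys (x b).
    scale_vec (Poly_Mapping.single t (Poly_Mapping.lookup (x b) t)) (part (m - Poly_Mapping.map int t) (unit_vec b)))"
proof -
  have "x = (\<Sum>b\<in>B. scale_vec (x b) (unit_vec b))"
  proof
    fix b'
    have "(\<Sum>b\<in>B. scale_vec (x b) (unit_vec b)) b' = (\<Sum>b\<in>B. if b' = b then x b else 0)"
      by (auto simp: sum_fun_apply unit_vec_def intro!: sum.cong)
    also have "\<dots> = x b'"
      using assms finite_B by (simp add: free_vecs_def)
    finally show "x b' = (\<Sum>b\<in>B. scale_vec (x b) (unit_vec b)) b'" by simp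
  qed
  also have "\<dots> = (\<Sum>b\<in>B. \<Sum>t\<in>Poly_Mapping.keys (x b).
      scale_vec (Poly_Mapping.single t (Poly_Mapping.lookup (x b) t)) (unit_vec b))"
    by (intro sum.cong refl) (simp add: scale_vec_sum_left[symmetric] sum_single_lookup)
  finally have x: "x = \<dots>" .
  have t: "Poly_Mapping.keys t \<subseteq> {..<d}" if "t \<in> Poly_Mapping.keys (x b)" for b t
    using assms that by (auto simp: free_vecs_def carrier_mpoly_ring)
  have F: "scale_vec (Poly_Mapping.single t c) (unit_vec b) \<in> F"
    if "b \<in> B" "t \<in> Poly_Mapping.keys (x b)" for b t c
    using that t by (intro free_vecs_smult unit_vec_F single_in_mpoly_ring)
  have "part m x = (\<Sum>b\<in>B. \<Sum>t\<in>Poly_Mapping.keys (x b).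
      part m (scale_vec (Poly_Mapping.single t (Poly_Mapping.lookup (x b) t)) (unit_vec b)))"
    by (subst (1) x) (simp add: part_sum F free_vecs_sum)
  also have "\<dots> = (\<Sum>b\<in>B. \<Sum>t\<in>Poly_Mapping.keys (x b).
    scale_vec (Poly_Mapping.single t (Poly_Mapping.lookup (x b) t)) (part (m - Poly_Mapping.map int t) (unit_vec b)))"
    by (intro sum.cong refl part_smult unit_vec_F t) auto
  finally show ?thesis .
qed

end

section \<open>Homogeneous bases\<close>

definition total_degree :: "nat \<Rightarrow> (nat \<Rightarrow>\<^sub>0 int) \<Rightarrow> int" where
  "total_degree d m = (\<Sum>l<d. Poly_Mapping.lookup m l)"

lemma total_degree_diff: "total_degree d (m - n) = total_degree d m - total_degree d n"
  by (simp add: total_degree_def lookup_minus sum_subtractf)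

lemma total_degree_map_int: "0 \<le> total_degree d (Poly_Mapping.map int t)"
  by (simp add: total_degree_def sum_nonneg)

lemma total_degree_map_int_pos:
  assumes "t \<noteq> 0" "Poly_Mapping.keys t \<subseteq> {..<d}"
  shows "0 < total_degree d (Poly_Mapping.map int t)"
proof -
  obtain l where "Poly_Mapping.lookup t l \<noteq> 0"
    using assms(1) by (metis lookup_zero poly_mapping_eqI)
  then have "l < d" "0 < int (Poly_Mapping.lookup t l)"
    using assms(2) by (auto simp: in_keys_iff subset_iff)
  then show ?thesis
    unfolding total_degree_def by (intro sum_pos2[of _ l]) auto
qed

definition degree_le :: "(nat \<Rightarrow>\<^sub>0 int) \<Rightarrow> (nat \<Rightarrow>\<^sub>0 int) \<Rightarrow> bool" where
  "degree_le m n \<longleftrightarrow> (\<forall>l. Poly_Mapping.lookup m l \<le> Poly_Mapping.lookup n l)"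

lemma degree_le_refl [simp]: "degree_le m m"
  by (simp add: degree_le_def)

lemma degree_le_trans: "degree_le m n \<Longrightarrow> degree_le n k \<Longrightarrow> degree_le m k"
  unfolding degree_le_def by (meson order_trans)

lemma degree_le_shift: "degree_le m n \<Longrightarrow> degree_le m (Poly_Mapping.map int t + n)"
  by (simp add: degree_le_def lookup_add) (meson add_increasing of_nat_0_le_iff)

text \<open>The exponent of the monomial leading from degree \<open>m\<close> to degree
  \<open>n\<close>. Since \<open>nat\<close> truncates negative differences, it has this meaning
  only under \<open>degree_le m n\<close>.\<close>

definition shift :: "(nat \<Rightarrow>\<^sub>0 int) \<Rightarrow> (nat \<Rightarrow>\<^sub>0 int) \<Rightarrow> nat \<Rightarrow>\<^sub>0 nat" where
  "shift m n = Poly_Mapping.map nat (n - m)"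

lemma lookup_shift: "Poly_Mapping.lookup (shift m n) l = nat (Poly_Mapping.lookup n l - Poly_Mapping.lookup m l)"
  by (simp add: shift_def Poly_Mapping.map.rep_eq when_def lookup_minus)

lemma shift_refl [simp]: "shift m m = 0"
  by (rule poly_mapping_eqI) (simp add: lookup_shift)

lemma map_int_shift: "degree_le m n \<Longrightarrow> Poly_Mapping.map int (shift m n) = n - m"
  by (rule poly_mapping_eqI) (simp add: lookup_shift lookup_minus degree_le_def)

lemma shift_add: "degree_le m n \<Longrightarrow> shift m (Poly_Mapping.map int t + n) = t + shift m n"
  by (rule poly_mapping_eqI) (simp add: lookup_shift lookup_add degree_le_def add_diff_eq[symmetric] nat_add_distrib)

lemma keys_shift:
  assumes "m \<in> int_lattice d" "n \<in> int_lattice d"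
  shows "Poly_Mapping.keys (shift m n) \<subseteq> {..<d}"
proof
  fix l assume "l \<in> Poly_Mapping.keys (shift m n)"
  then have "l \<in> Poly_Mapping.keys m \<or> l \<in> Poly_Mapping.keys n"
    by (auto simp: in_keys_iff lookup_shift)
  with assms show "l \<in> {..<d}"
    unfolding int_lattice_def by blast
qed

text \<open>In degree \<open>m\<close> each generator \<open>f e\<close> has at most one monomial
  multiple, so scalars \<open>c e\<close> describe the whole combination. Using the same indices
  \<open>e\<close> for all \<open>m\<close> is what lets one matrix over k describe the differential
  in every degree.\<close>

definition homogeneous_comb ::
  "'e set \<Rightarrow> ('e \<Rightarrow> nat \<Rightarrow>\<^sub>0 int) \<Rightarrow> ('e \<Rightarrow> ('b, 'k::field) vec) \<Rightarrow> (nat \<Rightarrow>\<^sub>0 int) \<Rightarrow> ('e \<Rightarrow> 'k) \<Rightarrow> ('b, 'k) vec" where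
  "homogeneous_comb E a f m c =
    (\<Sum>e | e \<in> E \<and> degree_le (a e) m. scale_vec (Poly_Mapping.single (shift (a e) m) (c e)) (f e))"

lemma homogeneous_comb_zero [simp]: "homogeneous_comb E a f m (\<lambda>e. 0) = 0"
  by (simp add: homogeneous_comb_def scale_vec_simps)

lemma homogeneous_comb_add:
  "homogeneous_comb E a f m c + homogeneous_comb E a f m c' = homogeneous_comb E a f m (\<lambda>e. c e + c' e)"
  by (simp add: homogeneous_comb_def sum.distrib single_add scale_vec_simps)

text \<open>Raising the degree admits further elements of \<open>E\<close> to the sum; the default
  value 0 cancels those that were not below \<open>m\<close>.\<close>

lemma homogeneous_comb_shift:
  assumes "finite E"
  shows "scale_vec (Poly_Mapping.single t k) (homogeneous_comb E a f m c)
    = homogeneous_comb E a f (Poly_Mapping.map int t + m) (\<lambda>e. if degree_le (a e) m then k * c e else 0)"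
proof -
  have "homogeneous_comb E a f (Poly_Mapping.map int t + m) (\<lambda>e. if degree_le (a e) m then k * c e else 0)
    = (\<Sum>e | e \<in> E \<and> degree_le (a e) m. scale_vec (Poly_Mapping.single (t + shift (a e) m) (k * c e)) (f e))"
    unfolding homogeneous_comb_def using assms degree_le_shift
    by (intro sum.mono_neutral_cong_right) (auto simp: shift_add scale_vec_simps)
  then show ?thesis
    by (simp add: homogeneous_comb_def scale_vec_sum flip: scale_vec_simps(3) mult_single)
qed

lemma homogeneous_comb_basis:
  assumes "finite E" "e \<in> E"
  shows "homogeneous_comb E a f (a e) (\<lambda>e'. if e' = e then 1 else 0) = f e"
proof -
  have "homogeneous_comb E a f (a e) (\<lambda>e'. if e' = e then 1 else 0)
    = (\<Sum>e'\<in>{e}. scale_vec (Poly_Mapping.single (shift (a e') (a e)) (if e' = e then 1 else 0)) (f e'))"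
    unfolding homogeneous_comb_def using assms
    by (intro sum.mono_neutral_right) (auto simp: scale_vec_simps)
  then show ?thesis by (simp add: scale_vec_simps)
qed

lemma zero_in_range_homogeneous_comb: "0 \<in> range (homogeneous_comb E a f m)"
  by (metis homogeneous_comb_zero rangeI)

lemma add_in_range_homogeneous_comb:
  "x \<in> range (homogeneous_comb E a f m) \<Longrightarrow> y \<in> range (homogeneous_comb E a f m) \<Longrightarrow>
    x + y \<in> range (homogeneous_comb E a f m)"
  by (auto simp: homogeneous_comb_add)

lemma sum_in_range_homogeneous_comb:
  "(\<And>i. i \<in> I \<Longrightarrow> x i \<in> range (homogeneous_comb E a f m)) \<Longrightarrow>
    (\<Sum>i\<in>I. x i) \<in> range (homogeneous_comb E a f m)"
  by (induction I rule: infinite_finite_induct)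
    (simp_all add: zero_in_range_homogeneous_comb add_in_range_homogeneous_comb)

text \<open>Reduction modulo (x_1, ..., x_d), from R^B to k^B.\<close>

definition constant_coeffs :: "('b, 'k::field) vec \<Rightarrow> 'b \<Rightarrow> 'k" where
  "constant_coeffs v = (\<lambda>b. Poly_Mapping.lookup (v b) 0)"

lemma constant_coeffs_zero: "constant_coeffs 0 = 0"
  by (simp add: constant_coeffs_def fun_eq_iff)

lemma constant_coeffs_sum: "constant_coeffs (\<Sum>i\<in>I. v i) = (\<Sum>i\<in>I. constant_coeffs (v i))"
  by (simp add: constant_coeffs_def fun_eq_iff sum_fun_apply lookup_sum)

lemma constant_coeffs_scalar:
  "constant_coeffs (scale_vec (Poly_Mapping.single 0 c) v) = scale_vec c (constant_coeffs v)"
  by (simp add: constant_coeffs_def fun_eq_iff lookup_single_zero_mult)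

lemma constant_coeffs_unit_vec: "constant_coeffs (unit_vec b) = unit_vec b"
  by (simp add: constant_coeffs_def fun_eq_iff unit_vec_def)

definition coeff_sums :: "('b, 'k::field) vec \<Rightarrow> 'b \<Rightarrow> 'k" where
  "coeff_sums v = (\<lambda>b. coeff_sum (v b))"

lemma coeff_sums_sum: "coeff_sums (\<Sum>i\<in>I. v i) = (\<Sum>i\<in>I. coeff_sums (v i))"
  by (simp add: coeff_sums_def fun_eq_iff sum_fun_apply coeff_sum_sum)

lemma coeff_sums_single: "coeff_sums (scale_vec (Poly_Mapping.single t c) v) = scale_vec c (coeff_sums v)"
  by (simp add: coeff_sums_def fun_eq_iff coeff_sum_single_mult)

lemma coeff_sums_unit_vec: "coeff_sums (unit_vec b) = unit_vec b"
  using coeff_sum_single[of 0 1] by (simp add: coeff_sums_def fun_eq_iff unit_vec_def)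

lemma vec_in_span_unit_vecs:
  fixes v :: "'b \<Rightarrow> 'k::field"
  assumes "finite B" "\<And>b. b \<notin> B \<Longrightarrow> v b = 0"
  shows "v \<in> coord.span (unit_vec ` B)"
proof -
  have "v = (\<Sum>b\<in>B. scale_vec (v b) (unit_vec b))"
  proof
    fix b'
    have "(\<Sum>b\<in>B. scale_vec (v b) (unit_vec b)) b' = (\<Sum>b\<in>B. if b' = b then v b else 0)"
      by (auto simp: sum_fun_apply unit_vec_def intro!: sum.cong)
    then show "v b' = (\<Sum>b\<in>B. scale_vec (v b) (unit_vec b)) b'"
      using assms by simp
  qed
  also have "\<dots> \<in> coord.span (unit_vec ` B)"
    by (intro coord.span_sum coord.span_scale coord.span_base imageI)
  finally show ?thesis .
qed

section \<open>Existence of a homogeneous basis with as many elements as \<open>B\<close>\<close>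

context graded_free
begin

text \<open>By \<open>part_expand\<close>, a degree with a nonzero element is the degree of a
  component of some unit vector plus that of a monomial, and monomials have nonnegative total
  degree.\<close>

lemma total_degree_bounded_below: "\<exists>lo. \<forall>m. \<forall>x\<in>comp m. x \<noteq> 0 \<longrightarrow> lo \<le> total_degree d m"
proof -
  define D where "D = (\<Union>b\<in>B. {m. part m (unit_vec b) \<noteq> 0})"
  have D: "finite D"
    unfolding D_def using finite_B finite_parts unit_vec_F by blast
  \<comment> \<open>\<open>Min\<close> is unspecified if \<open>D\<close> is empty, but a nonzero
    \<open>x\<close> produces an element of \<open>D\<close>.\<close>
  have "Min (total_degree d ` D) \<le> total_degree d m" if x: "x \<in> comp m" "x \<noteq> 0" for m x
  proof -
    have "part m x \<noteq> 0"
      using x by (simp add: part_of_comp)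
    then obtain b t where b: "b \<in> B" "part (m - Poly_Mapping.map int t) (unit_vec b) \<noteq> 0"
      using part_expand[OF comp_F[OF x(1)], of m]
      by (metis (no_types, lifting) scale_vec_simps(4) sum.neutral)
    then have "m - Poly_Mapping.map int t \<in> D"
      by (auto simp: D_def)
    then have "Min (total_degree d ` D) \<le> total_degree d (m - Poly_Mapping.map int t)"
      using D by simp
    with total_degree_map_int[of d t] show ?thesis
      by (simp add: total_degree_diff)
  qed
  then show ?thesis by blast
qed

text \<open>
  Homogeneous elements whose constant coefficients form a basis of \<open>k\<^sup>B\<close> generate by graded
  Nakayama.  They are independent because their coefficient sums, the values at \<open>x = (1, \<dots>, 1)\<close>,
  span \<open>k\<^sup>B\<close>, and there are only \<open>card B\<close> of them.
\<close>

lemma homogeneous_generators: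
  fixes E :: "'e set"
  assumes fin: "finite E" and f: "\<And>e. e \<in> E \<Longrightarrow> f e \<in> comp (a e)"
    and span: "\<And>x. x \<in> F \<Longrightarrow> \<exists>c. constant_coeffs x = (\<Sum>e\<in>E. scale_vec (c e) (constant_coeffs (f e)))"
    and x: "x \<in> comp m"
  shows "x \<in> range (homogeneous_comb E a f m)"
proof -
  obtain lo where lo: "\<And>m x. x \<in> comp m \<Longrightarrow> x \<noteq> 0 \<Longrightarrow> lo \<le> total_degree d m"
    using total_degree_bounded_below by metis
  have shift: "scale_vec (Poly_Mapping.single t k) y \<in> range (homogeneous_comb E a f m)"
    if y: "y \<in> range (homogeneous_comb E a f (m - Poly_Mapping.map int t))" for t k y m
  proof -
    obtain c where c: "y = homogeneous_comb E a f (m - Poly_Mapping.map int t) c"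
      using y by blast
    have "Poly_Mapping.map int t + (m - Poly_Mapping.map int t) = m" by simp
    then show ?thesis
      unfolding c homogeneous_comb_shift[OF fin] by simp
  qed
  \<comment> \<open>Induction on the distance from \<open>lo\<close>, below which every homogeneous
    element is zero.\<close>
  have "x \<in> range (homogeneous_comb E a f m)" if "total_degree d m < lo + int n" "x \<in> comp m" for n m x
    using that
  proof (induction n arbitrary: m x)
    case 0
    then have "x = 0" using lo by fastforce
    then show ?case by (simp only: zero_in_range_homogeneous_comb)
  next
    case (Suc n)
    have xF: "x \<in> F" using Suc.prems comp_F by blast
    obtain c where c: "constant_coeffs x = (\<Sum>e\<in>E. scale_vec (c e) (constant_coeffs (f e)))"
      using span[OF xF] by blast
    define g where "g e = scale_vec (Poly_Mapping.single 0 (c e)) (f e)" for e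
    have g: "g e \<in> comp (a e)" if "e \<in> E" for e
      using f[OF that] comp_scalar by (simp add: g_def)
    \<comment> \<open>\<open>y\<close> has no constant terms but is not homogeneous, as the
      \<open>g e\<close> have various degrees. Hence only \<open>part m y\<close> is expanded: each
      term there carries a monomial other than 1 and so a component of a unit vector in smaller
      total degree.\<close>
    define y where "y = x + - (\<Sum>e\<in>E. g e)"
    have yF: "y \<in> F"
      unfolding y_def sum_negf[symmetric] using xF g comp_F comp_uminus by (intro free_vecs_add free_vecs_sum) blast+
    have "constant_coeffs x = constant_coeffs (\<Sum>e\<in>E. g e)"
      by (simp add: c constant_coeffs_sum g_def constant_coeffs_scalar)
    then have y0: "Poly_Mapping.lookup (y b) 0 = 0" for b
      by (simp add: y_def constant_coeffs_def fun_eq_iff lookup_minus)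
    have "part m y \<in> range (homogeneous_comb E a f m)"
      unfolding part_expand[OF yF, of m]
    proof (intro sum_in_range_homogeneous_comb shift)
      fix b t assume b: "b \<in> B" and t: "t \<in> Poly_Mapping.keys (y b)"
      have "t \<noteq> 0" using t y0[of b] by (auto simp: in_keys_iff)
      moreover have "Poly_Mapping.keys t \<subseteq> {..<d}"
        using yF t by (auto simp: free_vecs_def carrier_mpoly_ring)
      ultimately have "total_degree d (m - Poly_Mapping.map int t) < lo + int n"
        using Suc.prems(1) total_degree_map_int_pos[of t d] by (simp add: total_degree_diff)
      then show "part (m - Poly_Mapping.map int t) (unit_vec b)
          \<in> range (homogeneous_comb E a f (m - Poly_Mapping.map int t))"
        using part_comp[OF unit_vec_F[OF b]] by (rule Suc.IH)
    qed
    moreover have "(\<Sum>e\<in>E. part m (g e)) \<in> range (homogeneous_comb E a f m)"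
    proof (rule sum_in_range_homogeneous_comb)
      fix e assume e: "e \<in> E"
      show "part m (g e) \<in> range (homogeneous_comb E a f m)"
      proof (cases "m = a e")
        case True
        then have "f e \<in> range (homogeneous_comb E a f m)"
          using homogeneous_comb_basis[OF fin e, of a f] by (metis rangeI)
        then have "g e \<in> range (homogeneous_comb E a f m)"
          unfolding g_def by (intro shift) simp
        then show ?thesis using True by (simp add: part_of_comp[OF g[OF e]])
      next
        case False
        then show ?thesis
          by (simp add: part_of_comp[OF g[OF e]] zero_in_range_homogeneous_comb)
      qed
    qed
    moreover have "x = part m y + (\<Sum>e\<in>E. part m (g e))"
    proof -
      have "part m x = x"
        using Suc.prems by (simp add: part_of_comp)
      moreover have "x = y + (\<Sum>e\<in>E. g e)"
        by (simp add: y_def)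
      moreover have "part m (y + (\<Sum>e\<in>E. g e)) = part m y + part m (\<Sum>e\<in>E. g e)"
        using yF g comp_F by (intro part_add free_vecs_sum) blast+
      moreover have "part m (\<Sum>e\<in>E. g e) = (\<Sum>e\<in>E. part m (g e))"
        using g comp_F by (intro part_sum) blast
      ultimately show ?thesis by simp
    qed
    ultimately show ?case
      by (metis add_in_range_homogeneous_comb)
  qed
  from this[of m "nat (total_degree d m - lo + 1)"] x show ?thesis by simp
qed

lemma homogeneous_independent:
  fixes E :: "'e set"
  assumes fin: "finite E" and card: "card E \<le> card B"
    and gen: "\<And>m x. x \<in> comp m \<Longrightarrow> x \<in> range (homogeneous_comb E a f m)"
    and zero: "homogeneous_comb E a f m c = 0" and e0: "e0 \<in> E" "degree_le (a e0) m"
  shows "c e0 = 0"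
proof (rule ccontr)
  assume c0: "c e0 \<noteq> 0"
  define g where "g e = coeff_sums (f e)" for e
  have g: "coeff_sums (homogeneous_comb E a f m c) = (\<Sum>e | e \<in> E \<and> degree_le (a e) m. scale_vec (c e) (g e))" for m c
    by (simp add: homogeneous_comb_def coeff_sums_sum coeff_sums_single g_def)
  \<comment> \<open>If \<open>c e0\<close> were nonzero, \<open>g e0\<close> would lie in the span
    of the other values, and fewer than \<open>card B\<close> vectors would span all the unit
    vectors.\<close>
  let ?W = "g ` (E - {e0})" and ?K = "{e. e \<in> E \<and> degree_le (a e) m}"
  have "scale_vec (c e0) (g e0) + (\<Sum>e\<in>?K - {e0}. scale_vec (c e) (g e)) = (\<Sum>e\<in>?K. scale_vec (c e) (g e))"
    using fin e0 by (intro sum.remove[symmetric]) auto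
  also have "\<dots> = coeff_sums 0"
    by (simp flip: g zero)
  also have "\<dots> = 0"
    by (simp add: coeff_sums_def fun_eq_iff)
  finally have "scale_vec (c e0) (g e0) = - (\<Sum>e\<in>?K - {e0}. scale_vec (c e) (g e))"
    by (rule eq_neg_iff_add_eq_0[THEN iffD2])
  also have "\<dots> \<in> coord.span ?W"
    by (intro coord.span_neg coord.span_sum coord.span_scale coord.span_base) auto
  finally have "scale_vec (inverse (c e0)) (scale_vec (c e0) (g e0)) \<in> coord.span ?W"
    by (rule coord.span_scale)
  with c0 have "g e0 \<in> coord.span ?W"
    by simp
  then have gE: "g e \<in> coord.span ?W" if "e \<in> E" for e
    using that by (cases "e = e0") (auto intro: coord.span_base)
  have "unit_vec ` B \<subseteq> coord.span ?W"
  proof safe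
    fix b assume b: "b \<in> B"
    have "unit_vec b = coeff_sums (\<Sum>m | part m (unit_vec b) \<noteq> 0. part m (unit_vec b))"
      by (simp add: sum_parts[OF unit_vec_F[OF b]] coeff_sums_unit_vec)
    also have "\<dots> \<in> coord.span ?W"
      unfolding coeff_sums_sum
    proof (rule coord.span_sum)
      fix m
      obtain c' where "part m (unit_vec b) = homogeneous_comb E a f m c'"
        using gen[OF part_comp[OF unit_vec_F[OF b]]] by blast
      then show "coeff_sums (part m (unit_vec b)) \<in> coord.span ?W"
        using gE by (auto simp: g intro!: coord.span_sum coord.span_scale)
    qed
    finally show "unit_vec b \<in> coord.span ?W" .
  qed
  from coord.independent_span_bound[OF _ independent_unit_vecs this] fin
  have "card (unit_vec ` B :: ('b \<Rightarrow> 'k) set) \<le> card ?W"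
    by simp
  also have "\<dots> \<le> card (E - {e0})"
    using fin by (intro card_image_le) simp
  also have "\<dots> < card E"
    using fin e0 by (intro psubset_card_mono) auto
  finally show False
    using card by (simp add: card_image inj_on_subset[OF inj_unit_vec])
qed

text \<open>The basis is indexed by its own constant coefficients: \<open>E\<close> is a maximal
  independent set of constant vectors of homogeneous elements, and \<open>f e\<close> is a
  homogeneous lift of \<open>e\<close>. These constant vectors span k^B because each unit vector is
  the sum of its components.\<close>

theorem homogeneous_basis:
  obtains E :: "('b \<Rightarrow> 'k) set" and a f where "finite E" "card E = card B"
    "\<And>e. e \<in> E \<Longrightarrow> f e \<in> comp (a e)" "\<And>e. e \<in> E \<Longrightarrow> a e \<in> int_lattice d"
    "\<And>m x. x \<in> comp m \<Longrightarrow> x \<in> range (homogeneous_comb E a f m)"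
    "\<And>m c e. homogeneous_comb E a f m c = 0 \<Longrightarrow> e \<in> E \<Longrightarrow> degree_le (a e) m \<Longrightarrow> c e = 0"
proof -
  let ?U = "unit_vec ` B :: ('b \<Rightarrow> 'k) set"
  define H where "H = (\<Union>m. constant_coeffs ` comp m)"
  obtain E where E: "E \<subseteq> H" "coord.independent E" "H \<subseteq> coord.span E"
    by (rule coord.maximal_independent_subset)
  have const: "constant_coeffs x \<in> coord.span ?U" if "x \<in> F" for x
    using that finite_B by (intro vec_in_span_unit_vecs) (simp_all add: free_vecs_def constant_coeffs_def)
  have "unit_vec b \<in> coord.span E" if b: "b \<in> B" for b
  proof -
    have "unit_vec b = constant_coeffs (\<Sum>m | part m (unit_vec b) \<noteq> 0. part m (unit_vec b))"
      by (simp add: sum_parts[OF unit_vec_F[OF b]] constant_coeffs_unit_vec)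
    also have "\<dots> \<in> coord.span E"
      unfolding constant_coeffs_sum using E(3) part_comp[OF unit_vec_F[OF b]]
      by (intro coord.span_sum) (auto simp: H_def)
    finally show ?thesis .
  qed
  then have U: "?U \<subseteq> coord.span E" by blast
  have "E \<subseteq> coord.span ?U"
    using E(1) const comp_F by (fastforce simp: H_def)
  then have fin: "finite E" and "card E \<le> card ?U"
    using coord.independent_span_bound[OF finite_imageI[OF finite_B] E(2)] by simp_all
  moreover have "card ?U \<le> card E"
    using coord.independent_span_bound[OF fin independent_unit_vecs U] by simp
  moreover have "card ?U = card B"
    by (simp add: card_image inj_on_subset[OF inj_unit_vec])
  ultimately have card: "card E = card B" by simp
  have "\<forall>e\<in>E. \<exists>m x. x \<in> comp m \<and> constant_coeffs x = e"
    using E(1) unfolding H_def by blast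
  then obtain a f where f: "\<And>e. e \<in> E \<Longrightarrow> f e \<in> comp (a e)" "\<And>e. e \<in> E \<Longrightarrow> constant_coeffs (f e) = e"
    by metis
  have gen: "x \<in> range (homogeneous_comb E a f m)" if "x \<in> comp m" for m x
  proof (rule homogeneous_generators[OF fin f(1) _ that])
    fix y assume "y \<in> F"
    then have "constant_coeffs y \<in> coord.span E"
      using const coord.span_mono[OF U] by (auto simp: coord.span_span)
    then obtain c where "constant_coeffs y = (\<Sum>e\<in>E. scale_vec (c e) e)"
      by (auto simp: coord.span_finite[OF fin])
    then show "\<exists>c. constant_coeffs y = (\<Sum>e\<in>E. scale_vec (c e) (constant_coeffs (f e)))"
      using f(2) by auto
  qed
  \<comment> \<open>Members of an independent set are nonzero, so their lifts are nonzero as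
    well.\<close>
  have lattice: "a e \<in> int_lattice d" if "e \<in> E" for e
  proof (rule comp_lattice[OF f(1)[OF that]])
    have "e \<noteq> 0" using E(2) that coord.dependent_zero by blast
    then show "f e \<noteq> 0"
      using f(2)[OF that] constant_coeffs_zero by metis
  qed
  show ?thesis
    using that[OF fin card f(1) lattice gen] homogeneous_independent[OF fin eq_refl[OF card] gen] by blast
qed

end

section \<open>Homogeneous differentials\<close>

lemma lookup_int_lattice: "m \<in> int_lattice d \<Longrightarrow> \<not> l < d \<Longrightarrow> Poly_Mapping.lookup m l = 0"
  by (auto simp: int_lattice_def in_keys_iff)

lemma homogeneous_comb_cong:
  "(\<And>e. e \<in> E \<Longrightarrow> degree_le (a e) m \<Longrightarrow> c e = c' e) \<Longrightarrow> homogeneous_comb E a f m c = homogeneous_comb E a f m c'"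
  unfolding homogeneous_comb_def by (intro sum.cong) auto

lemma homogeneous_comb_sum:
  "(\<Sum>i\<in>I. homogeneous_comb E a f m (c i)) = homogeneous_comb E a f m (\<lambda>e. \<Sum>i\<in>I. c i e)"
  by (induction I rule: infinite_finite_induct) (simp_all add: homogeneous_comb_add)

locale graded_free_differential = graded_free d B comp
  for d :: nat and B :: "'b set" and comp :: "(nat \<Rightarrow>\<^sub>0 int) \<Rightarrow> ('b, 'k::field) vec set" +
  fixes \<delta> :: "('b, 'k) vec \<Rightarrow> ('b, 'k) vec"
  assumes d_add: "x \<in> free_vecs d B \<Longrightarrow> y \<in> free_vecs d B \<Longrightarrow> \<delta> (x + y) = \<delta> x + \<delta> y"
    and d_smult: "p \<in> carrier (mpoly_ring d) \<Longrightarrow> x \<in> free_vecs d B \<Longrightarrow> \<delta> (scale_vec p x) = scale_vec p (\<delta> x)"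
    and d_F: "x \<in> free_vecs d B \<Longrightarrow> \<delta> x \<in> free_vecs d B"
    and d_comp: "x \<in> comp m \<Longrightarrow> \<delta> x \<in> comp m"
    and d_square: "x \<in> free_vecs d B \<Longrightarrow> \<delta> (\<delta> x) = 0"
begin

lemma d_zero [simp]: "\<delta> 0 = 0"
  using d_add[OF free_vecs_zero free_vecs_zero] by simp

lemma d_sum: "(\<And>i. i \<in> I \<Longrightarrow> x i \<in> F) \<Longrightarrow> \<delta> (\<Sum>i\<in>I. x i) = (\<Sum>i\<in>I. \<delta> (x i))"
  by (induction I rule: infinite_finite_induct) (simp_all add: d_add free_vecs_sum)

lemma part_d:
  assumes "x \<in> F"
  shows "part m (\<delta> x) = \<delta> (part m x)"
proof (rule part_eqI)
  show "\<delta> (part m x) \<in> comp m" for m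
    using assms part_comp d_comp by blast
  show "finite {m. part m x \<noteq> 0}"
    using assms by (rule finite_parts)
  have "(\<Sum>m | part m x \<noteq> 0. \<delta> (part m x)) = \<delta> (\<Sum>m | part m x \<noteq> 0. part m x)"
    using assms part_comp comp_F by (intro d_sum[symmetric]) blast
  then show "(\<Sum>m | part m x \<noteq> 0. \<delta> (part m x)) = \<delta> x"
    by (simp only: sum_parts[OF assms])
  show "\<delta> (part m x) = 0" if "m \<notin> {m. part m x \<noteq> 0}" for m
    using that d_zero by (metis mem_Collect_eq)
qed

definition exact_at :: "(nat \<Rightarrow>\<^sub>0 int) \<Rightarrow> bool" where
  "exact_at m \<longleftrightarrow> (\<forall>z\<in>comp m. \<delta> z = 0 \<longrightarrow> z \<in> \<delta> ` comp m)"

text \<open>Since \<open>\<delta>\<close> commutes with taking components, the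
  degree-\<open>m\<close> component of any primitive is again a primitive.\<close>

lemma boundary_in_comp:
  assumes "z \<in> comp m" "z \<in> \<delta> ` F"
  shows "z \<in> \<delta> ` comp m"
proof -
  obtain y where y: "y \<in> F" "z = \<delta> y" using assms by blast
  have "z = part m z" using assms by (simp add: part_of_comp)
  also have "\<dots> = \<delta> (part m y)" using y by (simp add: part_d)
  finally show ?thesis using part_comp[OF y(1)] by blast
qed

lemma inexact_in_lattice: "\<not> exact_at m \<Longrightarrow> m \<in> int_lattice d"
  unfolding exact_at_def using comp_lattice comp_zero d_zero by (metis image_eqI)

text \<open>If all degrees were exact, primitives of the finitely many components of
  \<open>z\<close> would add up to a primitive of \<open>z\<close>.\<close>

lemma inexact_exists:
  assumes "z \<in> F" "\<delta> z = 0" "z \<notin> \<delta> ` F"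
  obtains m where "\<not> exact_at m"
proof -
  have False if exact: "\<And>m. exact_at m"
  proof -
    have "\<delta> (part m z) = 0" for m
      using part_d[OF assms(1), of m] assms(2) by simp
    then have "\<exists>y. y \<in> comp m \<and> part m z = \<delta> y" for m
      using exact[of m] part_comp[OF assms(1), of m] unfolding exact_at_def by blast
    then obtain y where y: "\<And>m. y m \<in> comp m" "\<And>m. part m z = \<delta> (y m)"
      by metis
    have "z = (\<Sum>m | part m z \<noteq> 0. \<delta> (y m))"
      using sum_parts[OF assms(1)] by (simp add: y(2))
    also have "\<dots> = \<delta> (\<Sum>m | part m z \<noteq> 0. y m)"
      using y(1) comp_F by (intro d_sum[symmetric]) blast
    also have "\<dots> \<in> \<delta> ` F"
      using y(1) comp_F by (intro imageI free_vecs_sum) blast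
    finally show False using assms(3) by blast
  qed
  with that show ?thesis by blast
qed

text \<open>These are the preimages of submodules of the homology, so chain conditions can be stated
  without a quotient. Closure under negatives is the case \<open>p = - 1\<close>.\<close>

definition intermediate_submodule :: "('b, 'k) vec set \<Rightarrow> bool" where
  "intermediate_submodule K \<longleftrightarrow> \<delta> ` F \<subseteq> K \<and> K \<subseteq> {x \<in> F. \<delta> x = 0} \<and>
    (\<forall>x\<in>K. \<forall>y\<in>K. x + y \<in> K) \<and> (\<forall>p\<in>carrier (mpoly_ring d). \<forall>x\<in>K. scale_vec p x \<in> K)"

text \<open>Preimage of the part of the homology in degrees whose \<open>l\<close>-th coordinate is
  at least \<open>s\<close>.\<close>

definition cycles_above :: "nat \<Rightarrow> int \<Rightarrow> ('b, 'k) vec set" where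
  "cycles_above l s = {x \<in> F. \<delta> x = 0 \<and> (\<forall>m. Poly_Mapping.lookup m l < s \<longrightarrow> part m x \<in> \<delta> ` F)}"

lemma boundary_zero: "0 \<in> \<delta> ` F"
  using free_vecs_zero d_zero by (metis image_eqI)

lemma boundary_add: "x \<in> \<delta> ` F \<Longrightarrow> y \<in> \<delta> ` F \<Longrightarrow> x + y \<in> \<delta> ` F"
  by (auto simp: d_add[symmetric] free_vecs_add)

lemma boundary_sum: "(\<And>i. i \<in> I \<Longrightarrow> x i \<in> \<delta> ` F) \<Longrightarrow> (\<Sum>i\<in>I. x i) \<in> \<delta> ` F"
  by (induction I rule: infinite_finite_induct) (simp_all add: boundary_zero boundary_add)

lemma boundary_smult: "p \<in> carrier (mpoly_ring d) \<Longrightarrow> x \<in> \<delta> ` F \<Longrightarrow> scale_vec p x \<in> \<delta> ` F"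
  by (auto simp: d_smult[symmetric] free_vecs_smult)

text \<open>Monomials never lower a coordinate: the component at \<open>m\<close> of x^t times
  \<open>x\<close> is x^t times the component of \<open>x\<close> at \<open>m - t\<close>, which is
  a boundary if the \<open>l\<close>-th coordinate of \<open>m\<close> is below
  \<open>s\<close>.\<close>

lemma cycles_above_submodule: "intermediate_submodule (cycles_above l s)"
  unfolding intermediate_submodule_def
proof (intro conjI ballI)
  show "\<delta> ` F \<subseteq> cycles_above l s"
    using d_square d_F comp_F[OF part_comp] by (auto simp: cycles_above_def part_d)
  show "cycles_above l s \<subseteq> {x \<in> F. \<delta> x = 0}"
    by (auto simp: cycles_above_def)
next
  fix x y assume "x \<in> cycles_above l s" "y \<in> cycles_above l s"
  then show "x + y \<in> cycles_above l s"
    by (auto simp: cycles_above_def free_vecs_add d_add part_add boundary_add)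
next
  fix p :: "(nat \<Rightarrow>\<^sub>0 nat) \<Rightarrow>\<^sub>0 'k" and x
  assume p: "p \<in> carrier (mpoly_ring d)" and "x \<in> cycles_above l s"
  then have x: "x \<in> F" "\<delta> x = 0" "\<And>m. Poly_Mapping.lookup m l < s \<Longrightarrow> part m x \<in> \<delta> ` F"
    by (auto simp: cycles_above_def)
  have t: "Poly_Mapping.keys t \<subseteq> {..<d}" if "t \<in> Poly_Mapping.keys p" for t
    using p that by (simp add: carrier_mpoly_ring)
  have "part m (scale_vec p x) \<in> \<delta> ` F" if m: "Poly_Mapping.lookup m l < s" for m
  proof -
    have "part m (scale_vec p x)
        = part m (\<Sum>t\<in>Poly_Mapping.keys p. scale_vec (Poly_Mapping.single t (Poly_Mapping.lookup p t)) x)"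
      by (simp add: sum_single_lookup flip: scale_vec_sum_left)
    also have "\<dots> = (\<Sum>t\<in>Poly_Mapping.keys p. part m (scale_vec (Poly_Mapping.single t (Poly_Mapping.lookup p t)) x))"
      using x t by (intro part_sum free_vecs_smult single_in_mpoly_ring)
    also have "\<dots> \<in> \<delta> ` F"
    proof (rule boundary_sum)
      fix t assume "t \<in> Poly_Mapping.keys p"
      note t = t[OF this]
      have "Poly_Mapping.lookup (m - Poly_Mapping.map int t) l < s"
        using m by (simp add: lookup_minus)
      then show "part m (scale_vec (Poly_Mapping.single t (Poly_Mapping.lookup p t)) x) \<in> \<delta> ` F"
        unfolding part_smult[OF x(1) t] using x t by (intro boundary_smult single_in_mpoly_ring)
    qed
    finally show ?thesis .
  qed
  moreover have "\<delta> (scale_vec p x) = 0"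
    using d_smult[OF p x(1)] x(2) by (simp add: scale_vec_simps)
  ultimately show "scale_vec p x \<in> cycles_above l s"
    using free_vecs_smult[OF p x(1)] by (simp add: cycles_above_def)
qed

text \<open>A nonzero class in a degree with \<open>l\<close>-th coordinate \<open>s\<close> makes
  the step from \<open>s\<close> to \<open>s + 1\<close> of the filtration strict, so stabilisation
  bounds that coordinate. For an upper bound it suffices to start the filtration at 0.\<close>

lemma inexact_degrees_bounded:
  assumes dcc: "\<And>K. (\<And>s. intermediate_submodule (K s)) \<Longrightarrow> (\<And>s. K (Suc s) \<subseteq> K s) \<Longrightarrow>
      \<exists>s0. \<forall>s\<ge>s0. K (Suc s) = K s"
  shows "\<exists>N. \<forall>m l. l < d \<longrightarrow> \<not> exact_at m \<longrightarrow> Poly_Mapping.lookup m l \<le> N"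
proof -
  have "\<exists>s0::nat. \<forall>m. \<not> exact_at m \<longrightarrow> Poly_Mapping.lookup m l \<le> int s0" for l
  proof -
    define K where "K s = cycles_above l (int s)" for s
    have "\<exists>s0. \<forall>s\<ge>s0. K (Suc s) = K s"
      by (rule dcc) (auto simp: K_def cycles_above_submodule, auto simp: cycles_above_def)
    then obtain s0 where s0: "\<And>s. s \<ge> s0 \<Longrightarrow> K (Suc s) = K s" by blast
    have "Poly_Mapping.lookup m l \<le> int s0" if inexact: "\<not> exact_at m" for m
    proof (rule ccontr)
      assume "\<not> Poly_Mapping.lookup m l \<le> int s0"
      then obtain s where s: "Poly_Mapping.lookup m l = int s" "s \<ge> s0"
        by (metis nat_int nle_le nonneg_int_cases of_nat_0_le_iff of_nat_mono order_trans zle_int)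
      obtain z where z: "z \<in> comp m" "\<delta> z = 0" "z \<notin> \<delta> ` F"
        using inexact boundary_in_comp unfolding exact_at_def by blast
      have "z \<in> K s"
        using z s comp_F boundary_zero by (auto simp: K_def cycles_above_def part_of_comp)
      moreover have "z \<notin> K (Suc s)"
        using z s by (auto simp: K_def cycles_above_def part_of_comp)
      ultimately show False using s0[OF s(2)] by blast
    qed
    then show ?thesis by blast
  qed
  then obtain s0 :: "nat \<Rightarrow> nat" where s0: "\<And>m l. \<not> exact_at m \<Longrightarrow> Poly_Mapping.lookup m l \<le> int (s0 l)"
    by metis
  \<comment> \<open>The sum of these natural numbers dominates each of them, giving one bound for
    all coordinates.\<close>
  have "Poly_Mapping.lookup m l \<le> int (\<Sum>l<d. s0 l)" if "l < d" "\<not> exact_at m" for m l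
    using s0[OF that(2), of l] member_le_sum[of l "{..<d}" s0] that(1)
    by (meson finite_lessThan lessThan_iff of_nat_mono order_trans zero_le)
  then show ?thesis by blast
qed

text \<open>For a lattice degree \<open>m\<close> the monomial multiples of the \<open>f e\<close>
  with \<open>e\<close> in \<open>S m\<close> form a basis of \<open>comp m\<close>, on which
  \<open>\<delta>\<close> acts by \<open>C\<close> restricted to \<open>S m\<close>. Exactness at
  \<open>m\<close> becomes acyclicity of a matrix.\<close>

theorem rank_bound:
  assumes "z \<in> F" "\<delta> z = 0" "z \<notin> \<delta> ` F"
    and dcc: "\<And>K. (\<And>s. intermediate_submodule (K s)) \<Longrightarrow> (\<And>s. K (Suc s) \<subseteq> K s) \<Longrightarrow>
      \<exists>s0. \<forall>s\<ge>s0. K (Suc s) = K s"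
  shows "2 ^ d \<le> card B"
proof -
  obtain E :: "('b \<Rightarrow> 'k) set" and a f where fin: "finite E" and card: "card E = card B"
    and f: "\<And>e. e \<in> E \<Longrightarrow> f e \<in> comp (a e)" and a: "\<And>e. e \<in> E \<Longrightarrow> a e \<in> int_lattice d"
    and gen: "\<And>m x. x \<in> comp m \<Longrightarrow> x \<in> range (homogeneous_comb E a f m)"
    and indep: "\<And>m c e. homogeneous_comb E a f m c = 0 \<Longrightarrow> e \<in> E \<Longrightarrow> degree_le (a e) m \<Longrightarrow> c e = 0"
    by (rule homogeneous_basis) blast
  have comb_eq: "v e = w e"
    if "homogeneous_comb E a f m v = homogeneous_comb E a f m w" "e \<in> E" "degree_le (a e) m" for m v w e
  proof -
    have "homogeneous_comb E a f m w + homogeneous_comb E a f m (\<lambda>e. v e - w e) = homogeneous_comb E a f m v"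
      by (simp add: homogeneous_comb_add)
    then have "homogeneous_comb E a f m (\<lambda>e. v e - w e) = 0"
      using that(1) by simp
    from indep[OF this that(2,3)] show ?thesis by simp
  qed
  have "\<forall>e\<in>E. \<exists>c. \<delta> (f e) = homogeneous_comb E a f (a e) c"
    using gen d_comp f by blast
  then obtain c where c: "\<And>e. e \<in> E \<Longrightarrow> \<delta> (f e) = homogeneous_comb E a f (a e) (c e)"
    by metis
  \<comment> \<open>When \<open>a i\<close> is not below \<open>a e\<close>, the combination ignores
    \<open>c e i\<close>, which may be anything; the default 0 makes \<open>C\<close> respect
    degrees.\<close>
  define C where "C i e = (if degree_le (a i) (a e) then c e i else 0)" for i e
  define S where "S m = {e \<in> E. degree_le (a e) m}" for m
  have comb_comp: "homogeneous_comb E a f m v \<in> comp m" if m: "m \<in> int_lattice d" for m v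
    unfolding homogeneous_comb_def
  proof (rule comp_sum, safe)
    fix e assume e: "e \<in> E" "degree_le (a e) m"
    have "Poly_Mapping.map int (shift (a e) m) + a e = m"
      using e(2) by (simp add: map_int_shift)
    then show "scale_vec (Poly_Mapping.single (shift (a e) m) (v e)) (f e) \<in> comp m"
      using comp_smult[OF keys_shift[OF a[OF e(1)] m] f[OF e(1)], of "v e"] by simp
  qed
  \<comment> \<open>\<open>\<delta>\<close> is linear over R, so passing from \<open>f e\<close> to
    a monomial multiple changes the monomials in its image but not the scalars.\<close>
  have d_comb: "\<delta> (homogeneous_comb E a f m v) = homogeneous_comb E a f m (matrix_apply C (S m) v)"
    if m: "m \<in> int_lattice d" for m v
  proof -
    have "\<delta> (homogeneous_comb E a f m v) = (\<Sum>e\<in>S m. \<delta> (scale_vec (Poly_Mapping.single (shift (a e) m) (v e)) (f e)))"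
      unfolding homogeneous_comb_def S_def using a m f comp_F
      by (intro d_sum free_vecs_smult single_in_mpoly_ring keys_shift) auto
    also have "\<dots> = (\<Sum>e\<in>S m. homogeneous_comb E a f m (\<lambda>i. C i e * v e))"
    proof (intro sum.cong refl)
      fix e assume "e \<in> S m"
      then have e: "e \<in> E" "degree_le (a e) m" by (auto simp: S_def)
      have "Poly_Mapping.map int (shift (a e) m) + a e = m"
        using e(2) by (simp add: map_int_shift)
      moreover have "\<delta> (scale_vec (Poly_Mapping.single (shift (a e) m) (v e)) (f e))
          = scale_vec (Poly_Mapping.single (shift (a e) m) (v e)) (homogeneous_comb E a f (a e) (c e))"
        unfolding c[OF e(1), symmetric]
        using e a m f comp_F by (intro d_smult single_in_mpoly_ring keys_shift) auto
      ultimately have "\<delta> (scale_vec (Poly_Mapping.single (shift (a e) m) (v e)) (f e))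
          = homogeneous_comb E a f m (\<lambda>i. if degree_le (a i) (a e) then v e * c e i else 0)"
        by (simp add: homogeneous_comb_shift[OF fin])
      also have "\<dots> = homogeneous_comb E a f m (\<lambda>i. C i e * v e)"
        by (intro homogeneous_comb_cong) (simp add: C_def)
      finally show "\<delta> (scale_vec (Poly_Mapping.single (shift (a e) m) (v e)) (f e))
          = homogeneous_comb E a f m (\<lambda>i. C i e * v e)" .
    qed
    also have "\<dots> = homogeneous_comb E a f m (matrix_apply C (S m) v)"
      by (simp add: homogeneous_comb_sum matrix_apply_def[abs_def])
    finally show ?thesis .
  qed
  have acyclic_iff: "acyclic_on C (S m) \<longleftrightarrow> exact_at m" if m: "m \<in> int_lattice d" for m
  proof
    assume acyclic: "acyclic_on C (S m)"
    show "exact_at m"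
      unfolding exact_at_def
    proof (intro ballI impI)
      fix y assume y: "y \<in> comp m" "\<delta> y = 0"
      obtain v where v: "y = homogeneous_comb E a f m v"
        using gen[OF y(1)] by blast
      have "\<forall>i\<in>S m. matrix_apply C (S m) v i = 0"
        using indep[of m "matrix_apply C (S m) v"] y(2) by (simp add: v d_comb[OF m] S_def)
      then obtain w where "\<forall>i\<in>S m. matrix_apply C (S m) w i = v i"
        using acyclic unfolding acyclic_on_def by blast
      then have "\<delta> (homogeneous_comb E a f m w) = y"
        unfolding v d_comb[OF m] by (intro homogeneous_comb_cong) (simp add: S_def)
      then show "y \<in> \<delta> ` comp m"
        using comb_comp[OF m] by blast
    qed
  next
    assume exact: "exact_at m"
    show "acyclic_on C (S m)"
      unfolding acyclic_on_def
    proof (intro allI impI)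
      fix v assume v: "\<forall>i\<in>S m. matrix_apply C (S m) v i = 0"
      have "\<delta> (homogeneous_comb E a f m v) = homogeneous_comb E a f m (\<lambda>e. 0)"
        unfolding d_comb[OF m] using v by (intro homogeneous_comb_cong) (simp add: S_def)
      then have "homogeneous_comb E a f m v \<in> \<delta> ` comp m"
        using exact comb_comp[OF m] unfolding exact_at_def by simp
      then obtain y where y: "y \<in> comp m" "homogeneous_comb E a f m v = \<delta> y" by blast
      obtain w where w: "y = homogeneous_comb E a f m w"
        using gen[OF y(1)] by blast
      have "homogeneous_comb E a f m (matrix_apply C (S m) w) = homogeneous_comb E a f m v"
        using y(2) by (simp add: w d_comb[OF m])
      then have "\<forall>i\<in>S m. matrix_apply C (S m) w i = v i"
        using comb_eq by (simp add: S_def)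
      then show "\<exists>w. \<forall>i\<in>S m. matrix_apply C (S m) w i = v i" by blast
    qed
  qed
  have C_le: "degree_le (a i) (a j)" if "C i j \<noteq> 0" for i j
    using that by (auto simp: C_def split: if_splits)
  have square: "square_zero_on C E"
    unfolding square_zero_on_def
  proof (intro ballI)
    fix i k assume i: "i \<in> E" and k: "k \<in> E"
    show "(\<Sum>j\<in>E. C i j * C j k) = 0"
    \<comment> \<open>If \<open>a i\<close> is below \<open>a k\<close>, the entry is the
      coefficient at \<open>f i\<close> of \<open>\<delta> (\<delta> (f k))\<close>. Otherwise no
      degree lies between, and every product vanishes.\<close>
    proof (cases "degree_le (a i) (a k)")
      case True
      have "homogeneous_comb E a f (a k) (\<lambda>j. C j k) = \<delta> (f k)"
        unfolding c[OF k] by (intro homogeneous_comb_cong) (simp add: C_def)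
      then have "homogeneous_comb E a f (a k) (matrix_apply C (S (a k)) (\<lambda>j. C j k)) = 0"
        using d_square[OF comp_F[OF f[OF k]]] by (simp flip: d_comb[OF a[OF k]])
      then have "(\<Sum>j\<in>S (a k). C i j * C j k) = 0"
        using indep[OF _ i True] by (simp add: matrix_apply_def[abs_def])
      moreover have "(\<Sum>j\<in>S (a k). C i j * C j k) = (\<Sum>j\<in>E. C i j * C j k)"
        using fin C_le by (intro sum.mono_neutral_left) (auto simp: S_def)
      ultimately show ?thesis by simp
    next
      case False
      then have "C i j * C j k = 0" for j
        using C_le degree_le_trans by (metis mult_eq_0_iff)
      then show ?thesis by (intro sum.neutral ballI)
    qed
  qed
  \<comment> \<open>Turns a bound on the first \<open>d\<close> coordinates, as used in
    \<open>two_power_le_card\<close>, into a lattice degree.\<close>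
  define deg where "deg n = (\<Sum>l<d. Poly_Mapping.single l (n l))" for n :: "nat \<Rightarrow> int"
  have lookup_deg: "Poly_Mapping.lookup (deg n) l = (if l < d then n l else 0)" for n l
    by (simp add: deg_def lookup_sum lookup_single when_def)
  then have deg: "deg n \<in> int_lattice d" for n
    by (auto simp: int_lattice_def in_keys_iff split: if_splits)
  have deg_le: "degree_le m (deg n) \<longleftrightarrow> (\<forall>l<d. Poly_Mapping.lookup m l \<le> n l)" if "m \<in> int_lattice d" for m n
    using lookup_int_lattice[OF that] by (auto simp: degree_le_def lookup_deg)
  have S_deg: "{e \<in> E. \<forall>l<d. Poly_Mapping.lookup (a e) l \<le> n l} = S (deg n)" for n
    using a deg_le by (auto simp: S_def)
  obtain N where N: "\<And>m l. l < d \<Longrightarrow> \<not> exact_at m \<Longrightarrow> Poly_Mapping.lookup m l \<le> N"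
    using inexact_degrees_bounded[OF dcc] by blast
  obtain m where m: "\<not> exact_at m"
    using inexact_exists[OF assms(1-3)] by blast
  have "deg (Poly_Mapping.lookup m) = m"
    using lookup_int_lattice[OF inexact_in_lattice[OF m]] by (intro poly_mapping_eqI) (simp add: lookup_deg)
  with m have m: "\<not> exact_at (deg (Poly_Mapping.lookup m))" by simp
  have "2 ^ d \<le> card E"
  proof (rule two_power_le_card[where C = C and a = "\<lambda>e. Poly_Mapping.lookup (a e)"])
    show "n l \<le> N"
      if "l < d" "\<not> acyclic_on C {e \<in> E. \<forall>l<d. Poly_Mapping.lookup (a e) l \<le> n l}" for n l
      using that N[of l "deg n"] by (simp add: S_deg acyclic_iff deg lookup_deg)
    show "\<not> acyclic_on C {e \<in> E. \<forall>l<d. Poly_Mapping.lookup (a e) l \<le> Poly_Mapping.lookup m l}"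
      using m by (simp add: S_deg acyclic_iff deg)
    show "Poly_Mapping.lookup (a i) l \<le> Poly_Mapping.lookup (a j) l" if "C i j \<noteq> 0" for i j l
      using C_le[OF that] by (simp add: degree_le_def)
  qed (use fin square in auto)
  then show ?thesis by (simp add: card)
qed

end

section \<open>Chains in quotient modules\<close>

lemma (in module) submodule_zero_closed: "Module.submodule H R M \<Longrightarrow> \<zero>\<^bsub>M\<^esub> \<in> H"
  using submoduleE(2,3,5)[of H] submoduleE(1)[of H] by (metis M.r_neg equals0I subsetD)

locale quotient_of_module = module R M for R and M (structure) +
  fixes N
  assumes N: "Module.submodule N R M"
begin

abbreviation "Q \<equiv> quotient_module M N"

interpretation N: abelian_subgroup N M
  using N M.abelian_group_axioms
  by (intro abelian_subgroupI3 additive_subgroup.intro) (simp_all add: Module.submodule_def)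

interpretation Q: module R Q
  by (rule quotient_module_is_module[OF N])

definition proj where "proj x = N +>\<^bsub>M\<^esub> x"

lemma carrier_quotient: "carrier Q = proj ` carrier M"
  by (auto simp: proj_def quotient_module_def A_RCOSETS_def RCOSETS_def a_r_coset_def)

lemma proj_add: "x \<in> carrier M \<Longrightarrow> y \<in> carrier M \<Longrightarrow> proj x \<oplus>\<^bsub>Q\<^esub> proj y = proj (x \<oplus>\<^bsub>M\<^esub> y)"
  by (simp add: proj_def quotient_module_def N.a_rcos_sum)

lemma proj_smult: "a \<in> carrier R \<Longrightarrow> x \<in> carrier M \<Longrightarrow> a \<odot>\<^bsub>Q\<^esub> proj x = proj (a \<odot>\<^bsub>M\<^esub> x)"
  using smult_coset[OF N] by (simp add: proj_def quotient_module_def)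

lemma proj_eq_zero: "x \<in> N \<Longrightarrow> proj x = \<zero>\<^bsub>Q\<^esub>"
  using N.a_rcos_const by (simp add: proj_def quotient_module_def)

lemma proj_zero: "proj ` N = {\<zero>\<^bsub>Q\<^esub>}"
proof
  show "proj ` N \<subseteq> {\<zero>\<^bsub>Q\<^esub>}" using proj_eq_zero by blast
  show "{\<zero>\<^bsub>Q\<^esub>} \<subseteq> proj ` N"
    using proj_eq_zero[OF submodule_zero_closed[OF N]] submodule_zero_closed[OF N] by (metis empty_subsetI imageI insert_subset)
qed

lemma submodule_proj:
  assumes K: "Module.submodule K R M"
  shows "Module.submodule (proj ` K) R Q"
proof (rule Q.submoduleI)
  have sub: "K \<subseteq> carrier M" by (rule submoduleE(1)[OF K])
  show "proj ` K \<subseteq> carrier Q"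
    using sub by (auto simp: carrier_quotient)
  show "\<zero>\<^bsub>Q\<^esub> \<in> proj ` K"
    using submodule_zero_closed[OF K] proj_eq_zero[OF submodule_zero_closed[OF N]] by (metis image_eqI)
  show smult: "a \<odot>\<^bsub>Q\<^esub> X \<in> proj ` K" if "a \<in> carrier R" "X \<in> proj ` K" for a X
    using that sub submoduleE(4)[OF K] by (auto simp: proj_smult subset_iff)
  show "X \<oplus>\<^bsub>Q\<^esub> Y \<in> proj ` K" if "X \<in> proj ` K" "Y \<in> proj ` K" for X Y
    using that sub submoduleE(5)[OF K] by (auto simp: proj_add subset_iff)
  show "\<ominus>\<^bsub>Q\<^esub> X \<in> proj ` K" if "X \<in> proj ` K" for X
  proof -
    have "X \<in> carrier Q" using that sub by (auto simp: carrier_quotient)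
    then have "\<ominus>\<^bsub>Q\<^esub> X = (\<ominus>\<^bsub>R\<^esub> \<one>\<^bsub>R\<^esub>) \<odot>\<^bsub>Q\<^esub> X"
      using Q.smult_l_minus[of "\<one>\<^bsub>R\<^esub>" X] by simp
    then show ?thesis using smult that by simp
  qed
qed

text \<open>Elements with the same class differ by an element of \<open>N\<close>, which lies in
  \<open>K\<close>. So strict inclusions above \<open>N\<close> stay strict in the quotient.\<close>

lemma proj_mem_iff:
  assumes K: "Module.submodule K R M" and NK: "N \<subseteq> K" and x: "x \<in> carrier M"
  shows "proj x \<in> proj ` K \<longleftrightarrow> x \<in> K"
proof
  assume "proj x \<in> proj ` K"
  then obtain y where y: "y \<in> K" "proj x = proj y" by blast
  then have "x \<in> N +>\<^bsub>M\<^esub> y"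
    using N.a_rcos_self[OF x] by (simp add: proj_def)
  then obtain n where "n \<in> N" "x = n \<oplus>\<^bsub>M\<^esub> y"
    by (auto simp: a_r_coset_def r_coset_def)
  then show "x \<in> K" using NK y submoduleE(5)[OF K] by blast
qed blast

lemma proj_strict_mono:
  assumes "Module.submodule K R M" "N \<subseteq> K" "K \<subset> K'" "K' \<subseteq> carrier M"
  shows "proj ` K \<subset> proj ` K'"
proof -
  obtain x where x: "x \<in> K'" "x \<notin> K" using assms(3) by blast
  then have "proj x \<notin> proj ` K"
    using proj_mem_iff[OF assms(1,2)] assms(4) by blast
  then show ?thesis using x assms(3) by blast
qed

text \<open>A descending chain that drops infinitely often, read backwards from its first drops,
  gives chains of every positive length in the quotient.\<close>

lemma descending_chain_stabilises:
  assumes finite: "finite_length R Q"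
    and K: "\<And>s. Module.submodule (K s) R M" "\<And>s. N \<subseteq> K s" and desc: "\<And>s. K (Suc s) \<subseteq> K s"
  shows "\<exists>s0. \<forall>s\<ge>s0. K (Suc s) = K s"
proof (rule ccontr)
  assume unstable: "\<not> ?thesis"
  define I where "I = {s. K (Suc s) \<noteq> K s}"
  have I: "infinite I"
    using unstable by (auto simp: I_def infinite_nat_iff_unbounded_le)
  define L where "L i = K (enumerate I i)" for i
  have anti: "K t \<subseteq> K s" if "s \<le> t" for s t
    using desc that by (rule lift_Suc_antimono_le)
  have L: "L (Suc i) \<subset> L i" for i
  proof -
    have "enumerate I i \<in> I" using I by (rule enumerate_in_set)
    then have "K (Suc (enumerate I i)) \<subset> K (enumerate I i)"
      using desc by (auto simp: I_def)
    moreover have "K (enumerate I (Suc i)) \<subseteq> K (Suc (enumerate I i))"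
      using enumerate_step[OF I, of i] by (intro anti) simp
    ultimately show ?thesis by (auto simp: L_def)
  qed
  have chain: "\<exists>T. submodule_chain R Q n T" if n: "n > 0" for n
  proof -
    \<comment> \<open>Besides the ends, \<open>J\<close> uses \<open>L (n - 1)\<close> down to
      \<open>L 1\<close>; the omitted \<open>L n\<close> and \<open>L 0\<close> make the first and
      last inclusions strict.\<close>
    define J where "J i = (if i = 0 then N else if i < n then L (n - i) else carrier M)" for i
    have J: "Module.submodule (J i) R M" "N \<subseteq> J i" for i
      using N K carrier_is_submodule N.a_subset by (auto simp: J_def L_def)
    have "J i \<subset> J (Suc i)" if "i < n" for i
    proof -
      have "J i \<subseteq> L (n - i)" using K(2) that by (auto simp: J_def L_def)
      also have "\<dots> \<subset> L (n - Suc i)" using L[of "n - Suc i"] that by (simp add: Suc_diff_Suc)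
      also have "\<dots> \<subseteq> J (Suc i)" using submoduleE(1)[OF K(1)] by (auto simp: J_def L_def)
      finally show ?thesis .
    qed
    then have "\<forall>i<n. proj ` J i \<subset> proj ` J (Suc i)"
      using J submoduleE(1) by (intro allI impI proj_strict_mono) blast+
    moreover have "proj ` J 0 = {\<zero>\<^bsub>Q\<^esub>}"
      using proj_zero by (simp add: J_def)
    moreover have "proj ` J n = carrier Q"
      using n by (simp add: J_def carrier_quotient)
    ultimately have "submodule_chain R Q n (\<lambda>i. proj ` J i)"
      using J submodule_proj by (simp add: submodule_chain_def)
    then show ?thesis by blast
  qed
  have "enat n \<le> module_length R Q" for n
  proof -
    have "enat (Suc n) \<le> module_length R Q"
      unfolding module_length_def using chain[of "Suc n"] by (intro Sup_upper) auto
    then show ?thesis by (meson enat_ord_simps(1) le_SucI le_refl order_trans)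
  qed
  moreover obtain l where "module_length R Q = enat l"
    using finite unfolding finite_length_def by auto
  ultimately show False
    by (metis Suc_n_not_le_n enat_ord_simps(1))
qed

end

section \<open>Coordinates of a graded module\<close>

text \<open>Finitely many generators involve only finitely many elements of \<open>B\<close>, which
  already span; a further element of \<open>B\<close> would depend on them. Finiteness matters
  because \<open>card\<close> of an infinite set is 0.\<close>

lemma (in module) finite_basis:
  assumes fg: "finitely_generated R M" and basis: "module_basis R M B" and nontrivial: "\<one>\<^bsub>R\<^esub> \<noteq> \<zero>\<^bsub>R\<^esub>"
  shows "finite B"
proof -
  have B: "B \<subseteq> carrier M" "lin_indpt B" "span B = carrier M"
    using basis by (auto simp: module_basis_def)
  obtain S where S: "finite S" "S \<subseteq> carrier M" "span S = carrier M"
    using fg by (auto simp: finitely_generated_def)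
  have "\<forall>s\<in>S. \<exists>A. finite A \<and> A \<subseteq> B \<and> s \<in> span A"
  proof
    fix s assume "s \<in> S"
    then have "s \<in> span B" using S(2) B(3) by blast
    then obtain a A where "s = lincomb a A" "finite A" "A \<subseteq> B" "a \<in> A \<rightarrow> carrier R"
      unfolding span_def by blast
    then show "\<exists>A. finite A \<and> A \<subseteq> B \<and> s \<in> span A"
      unfolding span_def by blast
  qed
  then obtain A where A: "\<And>s. s \<in> S \<Longrightarrow> finite (A s)" "\<And>s. s \<in> S \<Longrightarrow> A s \<subseteq> B" "\<And>s. s \<in> S \<Longrightarrow> s \<in> span (A s)"
    by metis
  define B0 where "B0 = (\<Union>s\<in>S. A s)"
  have B0: "finite B0" "B0 \<subseteq> B"
    using S(1) A(1,2) by (auto simp: B0_def)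
  then have B0M: "B0 \<subseteq> carrier M" using B(1) by blast
  have "S \<subseteq> span B0"
  proof
    fix s assume s: "s \<in> S"
    then have "A s \<subseteq> B0" by (auto simp: B0_def)
    then show "s \<in> span B0" using span_is_monotone A(3)[OF s] by blast
  qed
  then have "carrier M \<subseteq> span B0"
    unfolding S(3)[symmetric] by (rule span_is_subset[OF _ span_is_submodule[OF B0M]])
  have "b \<in> B0" if b: "b \<in> B" for b
  proof (rule ccontr)
    assume notin: "b \<notin> B0"
    have bM: "b \<in> carrier M" using b B(1) by blast
    then have "b \<in> span B0" using \<open>carrier M \<subseteq> span B0\<close> by blast
    then obtain a where a: "a \<in> B0 \<rightarrow> carrier R" "lincomb a B0 = b"
      using finite_in_span[OF B0(1) B0M] by blast
    \<comment> \<open>The coefficient -1 at \<open>b\<close> turns the expression of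
      \<open>b\<close> over \<open>B0\<close> into a linear relation.\<close>
    define c where "c = a(b := \<ominus>\<^bsub>R\<^esub> \<one>\<^bsub>R\<^esub>)"
    have c: "c \<in> B0 \<union> {b} \<rightarrow> carrier R" using a(1) by (auto simp: c_def)
    have "lincomb c B0 = lincomb a B0"
      using notin a(1) B0M by (intro lincomb_cong) (auto simp: c_def)
    then have "lincomb c (B0 \<union> {b}) = (\<ominus>\<^bsub>R\<^esub> \<one>\<^bsub>R\<^esub>) \<odot>\<^bsub>M\<^esub> b \<oplus>\<^bsub>M\<^esub> b"
      using lincomb_insert[OF B0(1) B0M c notin bM] a(2) by (simp add: c_def)
    also have "\<dots> = \<zero>\<^bsub>M\<^esub>"
      using bM smult_l_minus[of "\<one>\<^bsub>R\<^esub>" b] by (simp add: M.l_neg)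
    finally have zero: "lincomb c (B0 \<union> {b}) = \<zero>\<^bsub>M\<^esub>" .
    have "c b \<noteq> \<zero>\<^bsub>R\<^esub>"
      using nontrivial R.minus_minus[OF R.one_closed] by (auto simp: c_def)
    then have "lin_dep B"
      using lin_dep_crit[of "B0 \<union> {b}" B c b] B0 b c zero by simp
    then show False using B(2) by blast
  qed
  then have "B \<subseteq> B0" by blast
  then show ?thesis using B0(1) by (rule finite_subset)
qed

locale coordinatized = Zd_graded_differential_module d F comp \<delta>
  for d :: nat and F :: "((nat \<Rightarrow>\<^sub>0 nat) \<Rightarrow>\<^sub>0 'k::field, 'b, 'm) module_scheme" (structure)
    and comp :: "(nat \<Rightarrow>\<^sub>0 int) \<Rightarrow> 'b set" and \<delta> :: "'b \<Rightarrow> 'b" +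
  fixes B :: "'b set"
  assumes finite_B: "finite B" and basis: "module_basis (mpoly_ring d) F B"
begin

lemma B_carrier: "B \<subseteq> carrier F"
  using basis by (simp add: module_basis_def)

section \<open>The isomorphism from R^B to \<open>F\<close> given by the basis\<close>

definition eval :: "('b, 'k) vec \<Rightarrow> 'b" where
  "eval v = lincomb v B"

lemma free_vecs_Pi: "v \<in> free_vecs d B \<Longrightarrow> v \<in> B \<rightarrow> carrier (mpoly_ring d)"
  by (simp add: free_vecs_def)

lemma eval_closed: "v \<in> free_vecs d B \<Longrightarrow> eval v \<in> carrier F"
  unfolding eval_def using B_carrier free_vecs_Pi by (intro lincomb_closed)

lemma eval_add:
  assumes "v \<in> free_vecs d B" "w \<in> free_vecs d B"
  shows "eval (v + w) = eval v \<oplus>\<^bsub>F\<^esub> eval w"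
  using lincomb_sum[OF finite_B B_carrier free_vecs_Pi[OF assms(1)] free_vecs_Pi[OF assms(2)]]
  by (simp add: eval_def plus_fun_def)

lemma eval_smult:
  assumes "p \<in> carrier (mpoly_ring d)" "v \<in> free_vecs d B"
  shows "eval (scale_vec p v) = p \<odot>\<^bsub>F\<^esub> eval v"
  using lincomb_smult[OF B_carrier free_vecs_Pi[OF assms(2)] assms(1)]
  by (simp add: eval_def scale_vec_def)

lemma eval_eq_zero:
  assumes v: "v \<in> free_vecs d B" and "eval v = \<zero>\<^bsub>F\<^esub>"
  shows "v = 0"
proof
  fix b
  show "v b = 0 b"
  proof (cases "b \<in> B")
    case True
    then show ?thesis
      using lin_dep_crit[OF finite_B subset_refl free_vecs_Pi[OF v] True] assms basis
      by (auto simp: eval_def module_basis_def)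
  next
    case False
    then show ?thesis using v by (simp add: free_vecs_def)
  qed
qed

lemma minus_one_closed: "- 1 \<in> carrier (mpoly_ring d :: ((nat \<Rightarrow>\<^sub>0 nat) \<Rightarrow>\<^sub>0 'k) ring)"
  by (simp add: carrier_mpoly_ring)

lemma inj_on_eval: "inj_on eval (free_vecs d B)"
proof (rule inj_onI)
  fix v w :: "('b, 'k) vec" assume v: "v \<in> free_vecs d B" and w: "w \<in> free_vecs d B" and eq: "eval v = eval w"
  let ?m = "scale_vec (- 1) w"
  have m: "?m \<in> free_vecs d B"
    using minus_one_closed w by (rule free_vecs_smult)
  have "eval (v + ?m) = eval (w + ?m)"
    using v w m eq by (simp add: eval_add)
  also have "w + ?m = 0" by (simp add: scale_vec_simps)
  also have "eval 0 = \<zero>\<^bsub>F\<^esub>"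
    using eval_smult[OF _ free_vecs_zero, of 0] eval_closed[OF free_vecs_zero] smult_l_null
    by (simp add: scale_vec_simps carrier_mpoly_ring)
  finally have "v + ?m = 0"
    using v m by (intro eval_eq_zero free_vecs_add)
  then show "v = w" by (simp add: scale_vec_simps)
qed

lemma eval_surj: "eval ` free_vecs d B = carrier F"
proof
  show "eval ` free_vecs d B \<subseteq> carrier F" using eval_closed by blast
  show "carrier F \<subseteq> eval ` free_vecs d B"
  proof
    fix x assume "x \<in> carrier F"
    then have "x \<in> span B" using basis by (simp add: module_basis_def)
    then obtain a where a: "a \<in> B \<rightarrow> carrier (mpoly_ring d)" "lincomb a B = x"
      using finite_in_span[OF finite_B B_carrier] by blast
    define v where "v = (\<lambda>b. if b \<in> B then a b else 0)"
    have "eval v = x"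
      unfolding eval_def a(2)[symmetric] using a(1) B_carrier by (intro lincomb_cong) (auto simp: v_def)
    moreover have "v \<in> free_vecs d B"
      using a(1) R.zero_closed by (simp add: v_def free_vecs_def Pi_iff)
    ultimately show "x \<in> eval ` free_vecs d B" by blast
  qed
qed

definition coords :: "'b \<Rightarrow> ('b, 'k) vec" where
  "coords = the_inv_into (free_vecs d B) eval"

lemma eval_coords [simp]: "x \<in> carrier F \<Longrightarrow> eval (coords x) = x"
  using f_the_inv_into_f[OF inj_on_eval, of x] by (simp add: coords_def eval_surj)

lemma coords_eval [simp]: "v \<in> free_vecs d B \<Longrightarrow> coords (eval v) = v"
  unfolding coords_def by (intro the_inv_into_f_f inj_on_eval)

lemma coords_closed: "x \<in> carrier F \<Longrightarrow> coords x \<in> free_vecs d B"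
  unfolding coords_def by (rule the_inv_into_into[OF inj_on_eval]) (simp_all add: eval_surj)

lemma coords_add: "x \<in> carrier F \<Longrightarrow> y \<in> carrier F \<Longrightarrow> coords (x \<oplus>\<^bsub>F\<^esub> y) = coords x + coords y"
  using coords_eval[of "coords x + coords y"] by (simp add: eval_add free_vecs_add coords_closed)

lemma coords_smult: "p \<in> carrier (mpoly_ring d) \<Longrightarrow> x \<in> carrier F \<Longrightarrow> coords (p \<odot>\<^bsub>F\<^esub> x) = scale_vec p (coords x)"
  using coords_eval[of "scale_vec p (coords x)"] by (simp add: eval_smult free_vecs_smult coords_closed)

lemma coords_zero [simp]: "coords \<zero>\<^bsub>F\<^esub> = 0"
  using coords_add[of "\<zero>\<^bsub>F\<^esub>" "\<zero>\<^bsub>F\<^esub>"] by simp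

lemma eval_zero [simp]: "eval 0 = \<zero>\<^bsub>F\<^esub>"
  using eval_coords[of "\<zero>\<^bsub>F\<^esub>"] by simp

lemma coords_finsum:
  assumes "finite A" "f \<in> A \<rightarrow> carrier F"
  shows "coords (\<Oplus>\<^bsub>F\<^esub>a\<in>A. f a) = (\<Sum>a\<in>A. coords (f a))"
  using assms by (induction A rule: finite_induct) (simp_all add: coords_add Pi_iff)

lemma comp_carrier: "m \<in> int_lattice d \<Longrightarrow> x \<in> comp m \<Longrightarrow> x \<in> carrier F"
  using additive_subgroup.a_subset[OF component_subgroup] by blast

text \<open>Nothing is assumed about \<open>comp\<close> off the lattice, whereas
  \<open>graded_free\<close> is indexed by the whole type; there the component is set to
  zero.\<close>

definition comp_vecs :: "(nat \<Rightarrow>\<^sub>0 int) \<Rightarrow> ('b, 'k) vec set" where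
  "comp_vecs m = (if m \<in> int_lattice d then coords ` comp m else {0})"

lemma single_component:
  "Poly_Mapping.keys t \<subseteq> {..<d} \<Longrightarrow>
    (Poly_Mapping.single t c :: (nat \<Rightarrow>\<^sub>0 nat) \<Rightarrow>\<^sub>0 'k) \<in> mpoly_component d (Poly_Mapping.map int t)"
  by (simp add: mpoly_component_def single_in_mpoly_ring)

lemma graded_free: "graded_free d B comp_vecs"
proof
  show "finite B" by (rule finite_B)
next
  fix x m assume "x \<in> comp_vecs m"
  then show "x \<in> free_vecs d B"
    by (auto simp: comp_vecs_def comp_carrier coords_closed free_vecs_zero split: if_splits)
next
  fix x m assume "x \<in> comp_vecs m" "x \<noteq> 0"
  then show "m \<in> int_lattice d"
    by (auto simp: comp_vecs_def split: if_splits)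
next
  fix m
  have "\<zero>\<^bsub>F\<^esub> \<in> comp m" if "m \<in> int_lattice d"
    using component_subgroup[OF that] by (rule additive_subgroup.zero_closed)
  then show "0 \<in> comp_vecs m"
    unfolding comp_vecs_def using coords_zero by (metis image_eqI singletonI)
next
  fix x y m assume xy: "x \<in> comp_vecs m" "y \<in> comp_vecs m"
  show "x + y \<in> comp_vecs m"
  proof (cases "m \<in> int_lattice d")
    case True
    then obtain x' y' where "x' \<in> comp m" "x = coords x'" "y' \<in> comp m" "y = coords y'"
      using xy by (auto simp: comp_vecs_def)
    with True additive_subgroup.a_closed[OF component_subgroup[OF True], of x' y'] show ?thesis
      by (auto simp: comp_vecs_def coords_add[symmetric] comp_carrier)
  qed (use xy in \<open>simp add: comp_vecs_def\<close>)
next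
  fix t :: "nat \<Rightarrow>\<^sub>0 nat" and x m and c :: 'k assume t: "Poly_Mapping.keys t \<subseteq> {..<d}" and x: "x \<in> comp_vecs m"
  let ?t = "Poly_Mapping.map int t"
  have t_lattice: "?t \<in> int_lattice d" using t by (simp add: int_lattice_def)
  show "scale_vec (Poly_Mapping.single t c) x \<in> comp_vecs (?t + m)"
  proof (cases "m \<in> int_lattice d")
    case True
    have "?t + m \<in> int_lattice d"
      using t_lattice True keys_add[of ?t m] by (auto simp: int_lattice_def)
    moreover obtain x' where x': "x' \<in> comp m" "x = coords x'"
      using x True by (auto simp: comp_vecs_def)
    moreover have "Poly_Mapping.single t c \<odot>\<^bsub>F\<^esub> x' \<in> comp (?t + m)"
      using component_smult[OF t_lattice True single_component[OF t] x'(1)] .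
    moreover have "scale_vec (Poly_Mapping.single t c) x = coords (Poly_Mapping.single t c \<odot>\<^bsub>F\<^esub> x')"
      using x' True t by (simp add: coords_smult single_in_mpoly_ring comp_carrier)
    ultimately show ?thesis by (simp add: comp_vecs_def)
  next
    case False
    have "m = (?t + m) - ?t" by simp
    then have "?t + m \<notin> int_lattice d"
      using False t_lattice keys_diff[of "?t + m" ?t] by (auto simp: int_lattice_def)
    then show ?thesis using False x by (simp add: comp_vecs_def scale_vec_simps)
  qed
next
  fix v :: "('b, 'k) vec" assume v: "v \<in> free_vecs d B"
  obtain f where f: "f \<in> (\<Pi> m \<in> int_lattice d. comp m)" "\<And>m. m \<notin> int_lattice d \<Longrightarrow> f m = \<zero>\<^bsub>F\<^esub>"
    "finite {m. f m \<noteq> \<zero>\<^bsub>F\<^esub>}" "eval v = (\<Oplus>\<^bsub>F\<^esub> m \<in> {m. f m \<noteq> \<zero>\<^bsub>F\<^esub>}. f m)"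
    using direct_decomposition[OF eval_closed[OF v]] by blast
  have fF: "f m \<in> carrier F" for m
    using f(1) f(2)[of m] comp_carrier[of m] by (cases "m \<in> int_lattice d") (auto simp: Pi_iff)
  have "coords (f m) = 0 \<longleftrightarrow> f m = \<zero>\<^bsub>F\<^esub>" for m
    using eval_coords[OF fF[of m]] by (metis coords_zero eval_zero)
  then have supp: "{m. coords (f m) \<noteq> 0} = {m. f m \<noteq> \<zero>\<^bsub>F\<^esub>}" by simp
  have "v = coords (eval v)" using v by simp
  also have "\<dots> = (\<Sum>m | coords (f m) \<noteq> 0. coords (f m))"
    unfolding f(4) supp using f(3) fF by (intro coords_finsum) auto
  finally have "v = (\<Sum>m | coords (f m) \<noteq> 0. coords (f m))" .
  moreover have "coords (f m) \<in> comp_vecs m" for m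
    using f(1,2) by (auto simp: comp_vecs_def)
  ultimately show "\<exists>f. (\<forall>m. f m \<in> comp_vecs m) \<and> finite {m. f m \<noteq> 0} \<and> v = (\<Sum>m | f m \<noteq> 0. f m)"
    using f(3) supp by (intro exI[of _ "\<lambda>m. coords (f m)"]) simp
next
  fix f :: "(nat \<Rightarrow>\<^sub>0 int) \<Rightarrow> ('b, 'k) vec" and m
  assume f: "\<And>m. f m \<in> comp_vecs m" "finite {m. f m \<noteq> 0}" "(\<Sum>m | f m \<noteq> 0. f m) = 0"
  define g where "g m = eval (f m)" for m
  have fV: "f m \<in> free_vecs d B" for m
    using f(1)[of m] by (auto simp: comp_vecs_def comp_carrier coords_closed free_vecs_zero split: if_splits)
  have g: "g m \<in> comp m" if "m \<in> int_lattice d" for m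
    using f(1)[of m] that by (auto simp: comp_vecs_def g_def comp_carrier)
  have g0: "g m = \<zero>\<^bsub>F\<^esub>" if "m \<notin> int_lattice d" for m
    using f(1)[of m] that by (simp add: comp_vecs_def g_def)
  have gF: "g m \<in> carrier F" for m
    using fV eval_closed by (simp add: g_def)
  have "f m = 0 \<longleftrightarrow> g m = \<zero>\<^bsub>F\<^esub>" for m
    using eval_eq_zero[OF fV] by (auto simp: g_def)
  then have supp: "{m. f m \<noteq> 0} = {m. g m \<noteq> \<zero>\<^bsub>F\<^esub>}" by simp
  have "coords (\<Oplus>\<^bsub>F\<^esub> m \<in> {m. g m \<noteq> \<zero>\<^bsub>F\<^esub>}. g m) = (\<Sum>m | g m \<noteq> \<zero>\<^bsub>F\<^esub>. coords (g m))"
    using f(2) gF by (intro coords_finsum) (auto simp: supp)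
  also have "\<dots> = 0"
    using f(3) fV by (simp add: supp g_def)
  finally have "(\<Oplus>\<^bsub>F\<^esub> m \<in> {m. g m \<noteq> \<zero>\<^bsub>F\<^esub>}. g m) = \<zero>\<^bsub>F\<^esub>"
    using gF by (metis (no_types, lifting) M.finsum_closed Pi_I eval_coords eval_zero)
  \<comment> \<open>\<open>g\<close> and the zero family both decompose zero, so
    \<open>direct_decomposition\<close> identifies them.\<close>
  then have "g \<in> (\<Pi> m \<in> int_lattice d. comp m) \<and> (\<forall>m. m \<notin> int_lattice d \<longrightarrow> g m = \<zero>\<^bsub>F\<^esub>) \<and>
      finite {m. g m \<noteq> \<zero>\<^bsub>F\<^esub>} \<and> \<zero>\<^bsub>F\<^esub> = (\<Oplus>\<^bsub>F\<^esub> m \<in> {m. g m \<noteq> \<zero>\<^bsub>F\<^esub>}. g m)"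
    using g g0 f(2) by (simp add: supp)
  moreover have "(\<lambda>m. \<zero>\<^bsub>F\<^esub>) \<in> (\<Pi> m \<in> int_lattice d. comp m) \<and> (\<forall>m. m \<notin> int_lattice d \<longrightarrow> \<zero>\<^bsub>F\<^esub> = \<zero>\<^bsub>F\<^esub>) \<and>
      finite {m. \<zero>\<^bsub>F\<^esub> \<noteq> \<zero>\<^bsub>F\<^esub>} \<and> \<zero>\<^bsub>F\<^esub> = (\<Oplus>\<^bsub>F\<^esub> m \<in> {m. \<zero>\<^bsub>F\<^esub> \<noteq> \<zero>\<^bsub>F\<^esub>}. \<zero>\<^bsub>F\<^esub>)"
    using additive_subgroup.zero_closed[OF component_subgroup] by simp
  moreover have unique: "y = z" if "\<exists>!x. P x" "P y" "P z" for P and y z :: "(nat \<Rightarrow>\<^sub>0 int) \<Rightarrow> 'b"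
    using that by blast
  ultimately have "g = (\<lambda>m. \<zero>\<^bsub>F\<^esub>)"
    by (intro unique[OF direct_decomposition[OF M.zero_closed], of g "\<lambda>m. \<zero>\<^bsub>F\<^esub>"])
  then show "f m = 0"
    using eval_eq_zero[OF fV] by (simp add: g_def fun_eq_iff)
qed

definition d_vecs :: "('b, 'k) vec \<Rightarrow> ('b, 'k) vec" where
  "d_vecs v = coords (\<delta> (eval v))"

sublocale D: mod_hom "mpoly_ring d" F F \<delta>
  by (intro mod_hom.intro mod_hom_axioms.intro module_axioms differential_hom)

lemma graded_free_differential: "graded_free_differential d B comp_vecs d_vecs"
proof (rule graded_free_differential.intro[OF graded_free], unfold_locales)
  fix x y :: "('b, 'k) vec" assume "x \<in> free_vecs d B" "y \<in> free_vecs d B"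
  then show "d_vecs (x + y) = d_vecs x + d_vecs y"
    by (simp add: d_vecs_def eval_add eval_closed coords_add)
next
  fix p :: "(nat \<Rightarrow>\<^sub>0 nat) \<Rightarrow>\<^sub>0 'k" and x :: "('b, 'k) vec" assume "p \<in> carrier (mpoly_ring d)" "x \<in> free_vecs d B"
  then show "d_vecs (scale_vec p x) = scale_vec p (d_vecs x)"
    by (simp add: d_vecs_def eval_smult eval_closed coords_smult)
next
  fix x :: "('b, 'k) vec" assume x: "x \<in> free_vecs d B"
  then show "d_vecs x \<in> free_vecs d B"
    by (simp add: d_vecs_def eval_closed coords_closed)
  from x show "d_vecs (d_vecs x) = 0"
    by (simp add: d_vecs_def eval_closed differential_square)
next
  fix x m assume x: "x \<in> comp_vecs m"
  show "d_vecs x \<in> comp_vecs m"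
  proof (cases "m \<in> int_lattice d")
    case True
    then obtain x' where "x' \<in> comp m" "x = coords x'" using x by (auto simp: comp_vecs_def)
    with True differential_degree_zero[OF True] show ?thesis
      by (auto simp: comp_vecs_def d_vecs_def comp_carrier)
  qed (use x in \<open>simp add: comp_vecs_def d_vecs_def\<close>)
qed

section \<open>Nonzero homology and finite length in coordinates\<close>

lemma kernel_module: "module (mpoly_ring d) (F\<lparr>carrier := D.ker\<rparr>)"
  using submodule_is_module[OF D.ker_is_submodule] by simp

lemma submodule_kernelI:
  assumes "N \<subseteq> D.ker" "N \<noteq> {}" "\<And>x y. x \<in> N \<Longrightarrow> y \<in> N \<Longrightarrow> x \<oplus>\<^bsub>F\<^esub> y \<in> N"
    "\<And>p x. p \<in> carrier (mpoly_ring d) \<Longrightarrow> x \<in> N \<Longrightarrow> p \<odot>\<^bsub>F\<^esub> x \<in> N"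
  shows "Module.submodule N (mpoly_ring d) (F\<lparr>carrier := D.ker\<rparr>)"
proof -
  interpret Z: module "mpoly_ring d" "F\<lparr>carrier := D.ker\<rparr>" by (rule kernel_module)
  show ?thesis
  proof (rule Z.submoduleI)
    fix x assume x: "x \<in> N"
    then have "x \<in> carrier (F\<lparr>carrier := D.ker\<rparr>)" using assms(1) by auto
    from Z.smult_l_minus[OF R.one_closed this]
    have "\<ominus>\<^bsub>F\<lparr>carrier := D.ker\<rparr>\<^esub> x = (\<ominus>\<^bsub>mpoly_ring d\<^esub> \<one>\<^bsub>mpoly_ring d\<^esub>) \<odot>\<^bsub>F\<^esub> x"
      using Z.smult_one[OF \<open>x \<in> carrier (F\<lparr>carrier := D.ker\<rparr>)\<close>] by simp
    then show "\<ominus>\<^bsub>F\<lparr>carrier := D.ker\<rparr>\<^esub> x \<in> N"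
      using assms(4)[OF R.a_inv_closed[OF R.one_closed] x] by simp
  next
    obtain x where x: "x \<in> N" using assms(2) by blast
    then have "x \<in> carrier F" using assms(1) by (auto simp: D.ker_def)
    then have "\<zero>\<^bsub>mpoly_ring d\<^esub> \<odot>\<^bsub>F\<^esub> x = \<zero>\<^bsub>F\<^esub>" by (rule smult_l_null)
    then show "\<zero>\<^bsub>F\<lparr>carrier := D.ker\<rparr>\<^esub> \<in> N"
      using assms(4)[OF R.zero_closed x] by simp
  qed (use assms in auto)
qed

text \<open>Nonzero homology provides a cycle that is no boundary, and finite length the descending
  chain condition between boundaries and cycles; \<open>coords\<close> and \<open>eval\<close> carry
  both to R^B.\<close>

theorem rank_bound:
  assumes nonzero: "carrier (homology F \<delta>) \<noteq> {\<zero>\<^bsub>homology F \<delta>\<^esub>}"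
    and finite: "finite_length (mpoly_ring d) (homology F \<delta>)"
  shows "2 ^ d \<le> card B"
proof -
  let ?Z = "F\<lparr>carrier := D.ker\<rparr>"
  interpret V: graded_free_differential d B comp_vecs d_vecs
    by (rule graded_free_differential)
  have im_ker: "D.im \<subseteq> D.ker"
    using differential_square by (auto simp: D.im_def D.ker_def)
  have im: "Module.submodule D.im (mpoly_ring d) ?Z"
    using D.im_is_submodule im_ker unfolding LinearCombinations.submodule_def
    by (intro submodule_kernelI) auto
  interpret H: quotient_of_module "mpoly_ring d" ?Z D.im
    using kernel_module im by (intro quotient_of_module.intro quotient_of_module_axioms.intro)
  have im_eq: "coords x \<in> d_vecs ` free_vecs d B \<longleftrightarrow> x \<in> D.im" if "x \<in> carrier F" for x
  proof
    assume "coords x \<in> d_vecs ` free_vecs d B"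
    then obtain v where v: "v \<in> free_vecs d B" "coords x = coords (\<delta> (eval v))"
      by (auto simp: d_vecs_def)
    then have "x = \<delta> (eval v)"
      using that eval_closed D.f_im by (metis eval_coords)
    then show "x \<in> D.im" using v eval_closed by (auto simp: D.im_def)
  next
    assume "x \<in> D.im"
    then obtain y where y: "y \<in> carrier F" "x = \<delta> y" by (auto simp: D.im_def)
    then have "coords x = d_vecs (coords y)" by (simp add: d_vecs_def)
    then show "coords x \<in> d_vecs ` free_vecs d B" using coords_closed[OF y(1)] by blast
  qed
  have "\<not> D.ker \<subseteq> D.im"
  proof
    assume "D.ker \<subseteq> D.im"
    then have "D.ker = D.im" using im_ker by blast
    then have "carrier H.Q = {\<zero>\<^bsub>H.Q\<^esub>}"
      using H.proj_zero H.carrier_quotient by simp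
    then show False using nonzero by (simp add: homology_def)
  qed
  then obtain z where z: "z \<in> D.ker" "z \<notin> D.im" by blast
  then have zF: "z \<in> carrier F" "\<delta> z = \<zero>\<^bsub>F\<^esub>" by (auto simp: D.ker_def)
  show ?thesis
  proof (rule V.rank_bound)
    show "coords z \<in> V.F" using zF by (simp add: coords_closed)
    show "d_vecs (coords z) = 0" using zF by (simp add: d_vecs_def)
    show "coords z \<notin> d_vecs ` V.F" using im_eq z zF by simp
  next
    fix K :: "nat \<Rightarrow> ('b, 'k) vec set"
    assume K: "\<And>s. V.intermediate_submodule (K s)" and desc: "\<And>s. K (Suc s) \<subseteq> K s"
    have K1: "d_vecs ` free_vecs d B \<subseteq> K s" "K s \<subseteq> {x \<in> free_vecs d B. d_vecs x = 0}"
      "\<And>x y. x \<in> K s \<Longrightarrow> y \<in> K s \<Longrightarrow> x + y \<in> K s"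
      "\<And>p x. p \<in> carrier (mpoly_ring d) \<Longrightarrow> x \<in> K s \<Longrightarrow> scale_vec p x \<in> K s" for s
      using K[of s] by (auto simp: V.intermediate_submodule_def)
    have KF: "K s \<subseteq> free_vecs d B" for s using K1(2) by blast
    \<comment> \<open>The images under \<open>eval\<close> are submodules between
      \<open>D.im\<close> and \<open>D.ker\<close>; injectivity of \<open>eval\<close> brings
      stabilisation back to \<open>K\<close>.\<close>
    define L where "L s = eval ` K s" for s
    have im_L: "D.im \<subseteq> L s" for s
    proof
      fix x assume x: "x \<in> D.im"
      then have xF: "x \<in> carrier F" using D.f_im by (auto simp: D.im_def)
      then have "coords x \<in> K s" using im_eq x K1(1) by blast
      then show "x \<in> L s" using eval_coords[OF xF] unfolding L_def by (metis image_eqI)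
    qed
    have L: "Module.submodule (L s) (mpoly_ring d) ?Z" for s
    proof (rule submodule_kernelI)
      show "L s \<subseteq> D.ker"
      proof
        fix x assume "x \<in> L s"
        then obtain v where v: "v \<in> K s" "x = eval v" by (auto simp: L_def)
        then have v': "v \<in> free_vecs d B" "coords (\<delta> (eval v)) = 0" using K1(2) by (auto simp: d_vecs_def)
        then have "\<delta> (eval v) = \<zero>\<^bsub>F\<^esub>" using eval_coords[OF D.f_im[OF eval_closed[OF v'(1)]]] by simp
        then show "x \<in> D.ker" using v v' eval_closed by (simp add: D.ker_def)
      qed
      show "L s \<noteq> {}"
        using im_L[of s] M.zero_closed by (auto simp: D.im_def)
      show "x \<oplus>\<^bsub>F\<^esub> y \<in> L s" if xy: "x \<in> L s" "y \<in> L s" for x y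
      proof -
        obtain v w where "v \<in> K s" "x = eval v" "w \<in> K s" "y = eval w"
          using xy by (auto simp: L_def)
        then show ?thesis
          using K1(3) KF[of s] eval_add[of v w] unfolding L_def by (metis image_eqI subsetD)
      qed
      show "p \<odot>\<^bsub>F\<^esub> x \<in> L s" if p: "p \<in> carrier (mpoly_ring d)" and x: "x \<in> L s" for p x
      proof -
        obtain v where "v \<in> K s" "x = eval v" using x by (auto simp: L_def)
        then show ?thesis
          using p K1(4) KF[of s] eval_smult[of p v] unfolding L_def by (metis image_eqI subsetD)
      qed
    qed
    have "\<exists>s0. \<forall>s\<ge>s0. L (Suc s) = L s"
    proof (rule H.descending_chain_stabilises)
      show "finite_length (mpoly_ring d) H.Q" using finite by (simp add: homology_def)
      show "L (Suc s) \<subseteq> L s" for s using desc[of s] by (auto simp: L_def)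
    qed (use L im_L in auto)
    moreover have "L (Suc s) = L s \<longleftrightarrow> K (Suc s) = K s" for s
      unfolding L_def by (rule inj_on_image_eq_iff[OF inj_on_eval KF KF])
    ultimately show "\<exists>s0. \<forall>s\<ge>s0. K (Suc s) = K s" by simp
  qed
qed

end

theorem theorem1p1:
  fixes d :: nat
    and F :: "((nat \<Rightarrow>\<^sub>0 nat) \<Rightarrow>\<^sub>0 'k::field, 'b) module"
    and comp :: "(nat \<Rightarrow>\<^sub>0 int) \<Rightarrow> 'b set"
    and \<delta> :: "'b \<Rightarrow> 'b"
  assumes "Zd_graded_differential_module d F comp \<delta>"
    and "finitely_generated (mpoly_ring d) F"
    and "free_module (mpoly_ring d) F"
    and "carrier (homology F \<delta>) \<noteq> {\<zero>\<^bsub>homology F \<delta>\<^esub>}"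
    and "finite_length (mpoly_ring d) (homology F \<delta>)"
  shows "2 ^ d \<le> module_rank (mpoly_ring d) F"
proof -
  interpret Zd_graded_differential_module d F comp \<delta> by fact
  \<comment> \<open>The same choice as in \<open>module_rank\<close>, so the bound for this basis is
    the bound for the rank.\<close>
  define B where "B = (SOME B. module_basis (mpoly_ring d) F B)"
  have basis: "module_basis (mpoly_ring d) F B"
    using assms(3) unfolding free_module_def B_def by (rule someI_ex)
  have "finite B"
    using assms(2) basis by (rule finite_basis) simp
  with basis interpret coordinatized d F comp \<delta> B
    by unfold_locales
  show ?thesis
    using rank_bound assms(4,5) by (simp add: module_rank_def B_def)
qed

end
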